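(* Let $n\ge1$, $1\le d\le n$ and $\mathcal{L}=I(d,n)$. For any maximal chain $\mathcal{C}\in C(\mathcal{L})$, the Newton-Okounkov body $\mathrm{NO}_{\mathcal{C}}(\mathcal{L})$ is unimodularly equivalent to the Gelfand-Tsetlin polytope associated to $\mathrm{Gr}_{d,n}$.
   Context: Lattice: $I(d,n)=\{[i_1,\dots,i_d]\mid1\le i_1<\dots<i_d\le n\}$ with componentwise order (meet = componentwise minimum, join = componentwise maximum), minimal element $\mathbb{O}=[1,\dots,d]$; $C(\mathcal{L})$ is its set of maximal chains. An element $m$ is join-irreducible if $m=\ell\vee\ell'$ implies $m=\ell$ or $m=\ell'$ (so $\mathbb{O}$ is included); $J(\mathcal{L})$ is the set of these, and $\mathrm{Spec}(\ell)=\{m\in J(\mathcal{L})\mid m\le\ell\}$. A maximal chain $\mathcal{C}=\{\mathbb{O}=c_0<\dots<c_N\}$ (where $N=|J(\mathcal{L})|-1=d(n-d)$) determines an enumeration $J(\mathcal{L})=\{m_0=\mathbb{O},m_1,\dots,m_N\}$ with $m_i$ the unique element of $\mathrm{Spec}(c_i)\setminus\mathrm{Spec}(c_{i-1})$. Newton-Okounkov body: let $R(\mathcal{L})=\mathbb{C}[X_\ell\mid\ell\in\mathcal{L}]/\langle X_\ell X_{\ell'}-X_{\ell\wedge\ell'}X_{\ell\vee\ell'}\mid\ell,\ell'\text{ non-comparable}\rangle=\bigoplus_{i\ge0}R_i$ be the homogeneous coordinate ring of the (irreducible, projective) Hibi variety $\mathbb{X}_{\mathcal{L}}$, $x_\ell$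 the class of $X_\ell$, and $\hat x_{c_j}=x_{c_j}/x_{\mathbb{O}}$. These $\hat x_{c_1},\dots,\hat x_{c_N}$ are algebraically independent generators of the function field $\mathbb{C}(\mathbb{X}_{\mathcal{L}})$. Let $\mathbb{Z}^N$ carry the reverse lexicographic order ($\mathbf{a}>\mathbf{b}$ iff the last nonzero coordinate of $\mathbf{a}-\mathbf{b}$ is positive). The valuation $\nu_{\mathcal{C},\mathrm{Spec}}:\mathbb{C}(\mathbb{X}_{\mathcal{L}})\setminus\{0\}\to\mathbb{Z}^N$ sends $\hat x_{c_1}^{a_1}\cdots\hat x_{c_N}^{a_N}$ to $\sum_ja_j(\sum_{m_i\in\mathrm{Spec}(c_j)\setminus\{\mathbb{O}\}}\mathbf{e}_i)$, a polynomial to the minimum over its monomials, and $f/g$ to the difference of values. Put $\Gamma(R_i)=\{i\mathbf{e}_0+\nu_{\mathcal{C},\mathrm{Spec}}(h/x_{\mathbb{O}}^i)\mid h\in R_i\setminus\{0\}\}\subset\mathbb{Z}^{N+1}$ and $$\mathrm{NO}_{\mathcal{C}}(\mathcal{L})=\overline{\mathrm{conv}\Big(\bigcup_{j\ge1}\{\tfrac1jv\mid v\in\Gamma(R_j)\}\Big)},$$ which lies in the affine hyperplane where the $\mathbf{e}_0$-coordinate is $1$, identified with $\mathbb{R}^N$. Gelfand-Tsetlin polytope: it is by definition the order polytope of the root poset $R_{d,n}=\{\alpha_{i,j}\mid1\le i\le d\le j\le n-1\}$, ordered by $\alpha_{i,j}\ge\alpha_{i',j'}$ iff $i\le i'$ and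 $j\le j'$; its lattice points are its vertices, which are the characteristic functions in $\mathbb{R}^{R_{d,n}}$ of the order ideals (downward closed subsets, including the empty one) of $R_{d,n}$. Unimodular equivalence means equivalence under an affine isomorphism of the ambient lattices. *)

theory Defs
  imports
    "HOL-Analysis.Analysis"
    "HOL-Algebra.QuotRing"
    "HOL-Library.Poly_Mapping"
    "HOL-Library.Function_Algebras"
begin

section \<open>Real vectors indexed by a set\<close>

text \<open>
  A vector in \<open>\<real>\<^sup>I\<close> is a function \<open>'i \<Rightarrow> real\<close> vanishing outside \<open>I\<close>.  The topology on functions is the
  product topology, which for finite \<open>I\<close> induces the Euclidean topology on the closed
  subspace \<open>\<real>\<^sup>I\<close>.
\<close>

instantiation "fun" :: (type, real_vector) real_vector
begin

definition scaleR_fun :: "real \<Rightarrow> ('a \<Rightarrow> 'b) \<Rightarrow> 'a \<Rightarrow> 'b" where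
  "scaleR_fun r f = (\<lambda>x. r *\<^sub>R f x)"

instance
  by standard (auto simp: scaleR_fun_def plus_fun_def scaleR_add_right scaleR_add_left)

end

definition int_lattice :: "'i set \<Rightarrow> ('i \<Rightarrow> real) set" where
  "int_lattice I = {v. (\<forall>i\<in>I. v i \<in> \<int>) \<and> (\<forall>i. i \<notin> I \<longrightarrow> v i = 0)}"

text \<open>
  \<open>P \<subseteq> \<real>\<^sup>I\<close> and \<open>Q \<subseteq> \<real>\<^sup>J\<close> correspond under an affine isomorphism of the lattices
  \<open>\<int>\<^sup>I\<close> and \<open>\<int>\<^sup>J\<close>.  Only the restriction of the affine map to \<open>\<real>\<^sup>I\<close> (the span of \<open>\<int>\<^sup>I\<close>) matters.
\<close>
definition unimodularly_equivalent ::
  "'i set \<Rightarrow> ('i \<Rightarrow> real) set \<Rightarrow> 'j set \<Rightarrow> ('j \<Rightarrow> real) set \<Rightarrow> bool" where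
  "unimodularly_equivalent I P J Q \<longleftrightarrow>
     (\<exists>f b. linear f \<and>
        bij_betw (\<lambda>v. f v + b) (int_lattice I) (int_lattice J) \<and>
        (\<lambda>v. f v + b) ` P = Q)"


section \<open>The lattice \<open>I(d,n)\<close>\<close>

definition grassmann_lattice :: "nat \<Rightarrow> nat \<Rightarrow> nat list set" where
  "grassmann_lattice d n = {xs. length xs = d \<and> sorted_wrt (<) xs \<and> set xs \<subseteq> {1..n}}"

definition lat_le :: "nat list \<Rightarrow> nat list \<Rightarrow> bool" where
  "lat_le = list_all2 (\<le>)"

definition lat_meet :: "nat list \<Rightarrow> nat list \<Rightarrow> nat list" where
  "lat_meet = map2 min"

definition lat_join :: "nat list \<Rightarrow> nat list \<Rightarrow> nat list" where
  "lat_join = map2 max"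

definition lat_bot :: "nat \<Rightarrow> nat list" where
  "lat_bot d = [1..<Suc d]"

definition maximal_chains :: "nat \<Rightarrow> nat \<Rightarrow> nat list set set" where
  "maximal_chains d n = {C. pred_on.maxchain (grassmann_lattice d n) lat_le C}"

definition join_irreducibles :: "nat \<Rightarrow> nat \<Rightarrow> nat list set" where
  "join_irreducibles d n =
     {m \<in> grassmann_lattice d n.
        \<forall>l\<in>grassmann_lattice d n. \<forall>l'\<in>grassmann_lattice d n. m = lat_join l l' \<longrightarrow> m = l \<or> m = l'}"

definition lat_Spec :: "nat \<Rightarrow> nat \<Rightarrow> nat list \<Rightarrow> nat list set" where
  "lat_Spec d n l = {m \<in> join_irreducibles d n. lat_le m l}"

text \<open>The element \<open>c\<^sub>i\<close> of a chain: the one with exactly \<open>i\<close> chain elements strictly below it.\<close>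
definition chain_elem :: "nat list set \<Rightarrow> nat \<Rightarrow> nat list" where
  "chain_elem C i = (THE c. c \<in> C \<and> card {b \<in> C. lat_le b c \<and> b \<noteq> c} = i)"

text \<open>The enumeration \<open>m\<^sub>0, m\<^sub>1, \<dots>, m\<^sub>N\<close> of the join-irreducibles determined by a maximal chain.\<close>
definition irr_enum :: "nat \<Rightarrow> nat \<Rightarrow> nat list set \<Rightarrow> nat \<Rightarrow> nat list" where
  "irr_enum d n C i =
     (if i = 0 then lat_bot d
      else THE m. m \<in> lat_Spec d n (chain_elem C i) - lat_Spec d n (chain_elem C (i - 1)))"


section \<open>Polynomial rings and degree-zero fractions\<close>

text \<open>
  \<open>'v \<Rightarrow>\<^sub>0 nat\<close> is the type of monomials (exponent vectors) in variables from \<open>'v\<close>, and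
  \<open>('v \<Rightarrow>\<^sub>0 nat) \<Rightarrow>\<^sub>0 complex\<close> that of polynomials, multiplied by convolution.  \<open>poly_ring V\<close> is
  the subring \<open>\<complex>[X\<^sub>v | v \<in> V]\<close>.
\<close>
type_synonym 'v mon = "'v \<Rightarrow>\<^sub>0 nat"
type_synonym 'v cpoly = "('v \<Rightarrow>\<^sub>0 nat) \<Rightarrow>\<^sub>0 complex"

definition poly_ring :: "'v set \<Rightarrow> 'v cpoly ring" where
  "poly_ring V =
     \<lparr>carrier = {p. \<forall>m \<in> Poly_Mapping.keys p. Poly_Mapping.keys m \<subseteq> V},
      mult = (*), one = 1, zero = 0, add = (+)\<rparr>"

definition pconst :: "complex \<Rightarrow> 'v cpoly" where
  "pconst a = Poly_Mapping.single 0 a"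

definition pvar :: "'v \<Rightarrow> 'v cpoly" where
  "pvar v = Poly_Mapping.single (Poly_Mapping.single v 1) 1"

definition mon_degree :: "'v mon \<Rightarrow> nat" where
  "mon_degree m = (\<Sum>v\<in>Poly_Mapping.keys m. Poly_Mapping.lookup m v)"

definition homogeneous_polys :: "'v set \<Rightarrow> nat \<Rightarrow> 'v cpoly set" where
  "homogeneous_polys V i =
     {p \<in> carrier (poly_ring V). \<forall>m \<in> Poly_Mapping.keys p. mon_degree m = i}"

text \<open>
  For a graded domain \<open>R = \<Oplus>\<^sub>i A i\<close>, the field of fractions \<open>f / g\<close> with \<open>f\<close>, \<open>g\<close> homogeneous of
  the same degree, i.e. the function field of the projective variety with homogeneous
  coordinate ring \<open>R\<close>.  Fractions are equivalence classes of pairs.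
\<close>
definition frac_pairs :: "('a, 'm) ring_scheme \<Rightarrow> (nat \<Rightarrow> 'a set) \<Rightarrow> ('a \<times> 'a) set" where
  "frac_pairs R A = (\<Union>i. A i \<times> (A i - {\<zero>\<^bsub>R\<^esub>}))"

definition frac_rel ::
  "('a, 'm) ring_scheme \<Rightarrow> (nat \<Rightarrow> 'a set) \<Rightarrow> (('a \<times> 'a) \<times> ('a \<times> 'a)) set" where
  "frac_rel R A = {((f, g), (f', g')). (f, g) \<in> frac_pairs R A \<and> (f', g') \<in> frac_pairs R A \<and>
                     f \<otimes>\<^bsub>R\<^esub> g' = f' \<otimes>\<^bsub>R\<^esub> g}"

definition hom_frac :: "('a, 'm) ring_scheme \<Rightarrow> (nat \<Rightarrow> 'a set) \<Rightarrow> 'a \<Rightarrow> 'a \<Rightarrow> ('a \<times> 'a) set" where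
  "hom_frac R A f g = frac_rel R A `` {(f, g)}"

definition frac_field ::
  "('a, 'm) ring_scheme \<Rightarrow> (nat \<Rightarrow> 'a set) \<Rightarrow> ('a \<times> 'a) set ring" where
  "frac_field R A =
     \<lparr>carrier = frac_pairs R A // frac_rel R A,
      mult = (\<lambda>x y. \<Union>(f, g)\<in>x. \<Union>(f', g')\<in>y. hom_frac R A (f \<otimes>\<^bsub>R\<^esub> f') (g \<otimes>\<^bsub>R\<^esub> g')),
      one = hom_frac R A \<one>\<^bsub>R\<^esub> \<one>\<^bsub>R\<^esub>,
      zero = hom_frac R A \<zero>\<^bsub>R\<^esub> \<one>\<^bsub>R\<^esub>,
      add = (\<lambda>x y. \<Union>(f, g)\<in>x. \<Union>(f', g')\<in>y.
               hom_frac R A ((f \<otimes>\<^bsub>R\<^esub> g') \<oplus>\<^bsub>R\<^esub> (f' \<otimes>\<^bsub>R\<^esub> g)) (g \<otimes>\<^bsub>R\<^esub> g'))\<rparr>"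


section \<open>The Hibi ring and its function field\<close>

definition hibi_relations :: "nat \<Rightarrow> nat \<Rightarrow> nat list cpoly set" where
  "hibi_relations d n =
     {pvar l * pvar l' - pvar (lat_meet l l') * pvar (lat_join l l') | l l'.
        l \<in> grassmann_lattice d n \<and> l' \<in> grassmann_lattice d n \<and> \<not> lat_le l l' \<and> \<not> lat_le l' l}"

definition hibi_ideal :: "nat \<Rightarrow> nat \<Rightarrow> nat list cpoly set" where
  "hibi_ideal d n = genideal (poly_ring (grassmann_lattice d n)) (hibi_relations d n)"

definition hibi_ring :: "nat \<Rightarrow> nat \<Rightarrow> nat list cpoly set ring" where
  "hibi_ring d n = poly_ring (grassmann_lattice d n) Quot hibi_ideal d n"

definition hibi_class :: "nat \<Rightarrow> nat \<Rightarrow> nat list cpoly \<Rightarrow> nat list cpoly set" where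
  "hibi_class d n p = hibi_ideal d n +>\<^bsub>poly_ring (grassmann_lattice d n)\<^esub> p"

definition hibi_component :: "nat \<Rightarrow> nat \<Rightarrow> nat \<Rightarrow> nat list cpoly set set" where
  "hibi_component d n i = hibi_class d n ` homogeneous_polys (grassmann_lattice d n) i"

type_synonym hibi_fun = "(nat list cpoly set \<times> nat list cpoly set) set"

definition hibi_frac :: "nat \<Rightarrow> nat \<Rightarrow> nat list cpoly set \<Rightarrow> nat list cpoly set \<Rightarrow> hibi_fun" where
  "hibi_frac d n = hom_frac (hibi_ring d n) (hibi_component d n)"

definition hibi_field :: "nat \<Rightarrow> nat \<Rightarrow> hibi_fun ring" where
  "hibi_field d n = frac_field (hibi_ring d n) (hibi_component d n)"

definition x_hat :: "nat \<Rightarrow> nat \<Rightarrow> nat list \<Rightarrow> hibi_fun" where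
  "x_hat d n l = hibi_frac d n (hibi_class d n (pvar l)) (hibi_class d n (pvar (lat_bot d)))"

text \<open>The value of a polynomial in \<open>T\<^sub>1, \<dots>, T\<^sub>N\<close> at \<open>T\<^sub>j = x_hat c\<^sub>j\<close>.\<close>
definition eval_chain :: "nat \<Rightarrow> nat \<Rightarrow> nat list set \<Rightarrow> nat cpoly \<Rightarrow> hibi_fun" where
  "eval_chain d n C F =
     finsum (hibi_field d n)
       (\<lambda>m. hibi_frac d n (hibi_class d n (pconst (Poly_Mapping.lookup F m))) \<one>\<^bsub>hibi_ring d n\<^esub>
            \<otimes>\<^bsub>hibi_field d n\<^esub>
            finprod (hibi_field d n)
              (\<lambda>j. x_hat d n (chain_elem C j) [^]\<^bsub>hibi_field d n\<^esub> Poly_Mapping.lookup m j)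
              (Poly_Mapping.keys m))
       (Poly_Mapping.keys F)"


section \<open>The valuation and the Newton-Okounkov body\<close>

text \<open>\<open>a < b\<close> iff the last nonzero coordinate of \<open>b - a\<close> is positive.\<close>
definition revlex_less :: "(nat \<Rightarrow> int) \<Rightarrow> (nat \<Rightarrow> int) \<Rightarrow> bool" where
  "revlex_less a b \<longleftrightarrow> (\<exists>k. a k < b k \<and> (\<forall>i>k. a i = b i))"

definition chain_rank :: "nat \<Rightarrow> nat \<Rightarrow> nat" where
  "chain_rank d n = d * (n - d)"

definition Spec_weight :: "nat \<Rightarrow> nat \<Rightarrow> nat list set \<Rightarrow> nat list \<Rightarrow> nat \<Rightarrow> int" where
  "Spec_weight d n C l =
     (\<lambda>i. if i \<in> {1..chain_rank d n} \<and> irr_enum d n C i \<in> lat_Spec d n l - {lat_bot d}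
          then 1 else 0)"

definition mon_val :: "nat \<Rightarrow> nat \<Rightarrow> nat list set \<Rightarrow> nat mon \<Rightarrow> nat \<Rightarrow> int" where
  "mon_val d n C m =
     (\<lambda>i. \<Sum>j\<in>Poly_Mapping.keys m.
            int (Poly_Mapping.lookup m j) * Spec_weight d n C (chain_elem C j) i)"

text \<open>The minimum, for the reverse lexicographic order, over the monomials of a nonzero polynomial.\<close>
definition poly_val :: "nat \<Rightarrow> nat \<Rightarrow> nat list set \<Rightarrow> nat cpoly \<Rightarrow> nat \<Rightarrow> int" where
  "poly_val d n C F =
     (THE v. v \<in> mon_val d n C ` Poly_Mapping.keys F \<and>
             (\<forall>w \<in> mon_val d n C ` Poly_Mapping.keys F. w \<noteq> v \<longrightarrow> revlex_less v w))"

text \<open>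
  The valuation of a nonzero rational function \<open>h\<close>: write \<open>h = F / G\<close> with nonzero polynomials
  \<open>F\<close>, \<open>G\<close> in the algebraically independent generators \<open>x_hat c\<^sub>1, \<dots>, x_hat c\<^sub>N\<close>.
\<close>
definition valuation :: "nat \<Rightarrow> nat \<Rightarrow> nat list set \<Rightarrow> hibi_fun \<Rightarrow> nat \<Rightarrow> int" where
  "valuation d n C h =
     (THE v. \<exists>F \<in> carrier (poly_ring {1..chain_rank d n}) - {0}.
             \<exists>G \<in> carrier (poly_ring {1..chain_rank d n}) - {0}.
               h = eval_chain d n C F \<otimes>\<^bsub>hibi_field d n\<^esub> inv\<^bsub>hibi_field d n\<^esub> eval_chain d n C G \<and>
               v = poly_val d n C F - poly_val d n C G)"

text \<open>
  Elements of \<open>\<int>\<^sup>N\<^sup>+\<^sup>1\<close> are functions supported on \<open>{0..N}\<close>; valuations are supported on \<open>{1..N}\<close>.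
\<close>
definition Gamma_val :: "nat \<Rightarrow> nat \<Rightarrow> nat list set \<Rightarrow> nat \<Rightarrow> (nat \<Rightarrow> int) set" where
  "Gamma_val d n C i =
     {(\<lambda>k. int i * of_bool (k = 0)) +
        valuation d n C
          (hibi_frac d n h (hibi_class d n (pvar (lat_bot d)) [^]\<^bsub>hibi_ring d n\<^esub> i)) | h.
      h \<in> hibi_component d n i - {\<zero>\<^bsub>hibi_ring d n\<^esub>}}"

definition NO_body_homog :: "nat \<Rightarrow> nat \<Rightarrow> nat list set \<Rightarrow> (nat \<Rightarrow> real) set" where
  "NO_body_homog d n C =
     closure (convex hull
       (\<Union>j\<in>{1..}. {(1 / real j) *\<^sub>R (\<lambda>k. real_of_int (v k)) | v. v \<in> Gamma_val d n C j}))"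

text \<open>
  The body above lies in the hyperplane where coordinate 0 equals 1; forgetting that
  coordinate identifies the hyperplane with \<open>\<real>\<^sup>N\<close>.
\<close>
definition NO_body :: "nat \<Rightarrow> nat \<Rightarrow> nat list set \<Rightarrow> (nat \<Rightarrow> real) set" where
  "NO_body d n C = (\<lambda>v. v(0 := 0)) ` NO_body_homog d n C"


section \<open>The Gelfand-Tsetlin polytope\<close>

text \<open>
  Convention: points are order-reversing functions, so that the vertices are the
  characteristic functions of the order ideals (downward closed subsets).
\<close>
definition order_polytope :: "'a set \<Rightarrow> ('a \<Rightarrow> 'a \<Rightarrow> bool) \<Rightarrow> ('a \<Rightarrow> real) set" where
  "order_polytope A R =
     {f. (\<forall>a\<in>A. 0 \<le> f a \<and> f a \<le> 1) \<and>
         (\<forall>a\<in>A. \<forall>b\<in>A. R a b \<longrightarrow> f b \<le> f a) \<and>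
         (\<forall>a. a \<notin> A \<longrightarrow> f a = 0)}"

text \<open>The root \<open>\<alpha>\<^sub>i\<^sub>,\<^sub>j\<close> is encoded as the pair \<open>(i, j)\<close>.\<close>
definition root_poset :: "nat \<Rightarrow> nat \<Rightarrow> (nat \<times> nat) set" where
  "root_poset d n = {(i, j). 1 \<le> i \<and> i \<le> d \<and> d \<le> j \<and> j \<le> n - 1}"

definition root_le :: "nat \<times> nat \<Rightarrow> nat \<times> nat \<Rightarrow> bool" where
  "root_le = (\<lambda>(i', j') (i, j). i \<le> i' \<and> j \<le> j')"

definition GT_polytope :: "nat \<Rightarrow> nat \<Rightarrow> (nat \<times> nat \<Rightarrow> real) set" where
  "GT_polytope d n = order_polytope (root_poset d n) root_le"

end

theory Submission
  imports Defs "HOL-Computational_Algebra.Fraction_Field"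
begin

text \<open>
  By Birkhoff's theorem the lattice is the lattice of order ideals of the root poset, and the
  enumeration of the join-irreducibles along the chain is a linear extension of that poset.  The
  Hibi ring is the toric ring generated by the monomials \<open>t\<^sub>0 \<Prod>t\<^sub>i\<close>, the product taken over the
  ideal of a lattice element.  In these coordinates the valuation of a homogeneous element is its
  reverse lexicographically smallest exponent, so the values in degree \<open>j\<close> are exactly the exponents
  of the monomials of degree \<open>j\<close>.  Hence the body is the convex hull of the indicators of the
  order ideals, which is the order polytope of the root poset with its roots numbered by the chain.
\<close>

section \<open>The lattice and its root poset\<close>

text \<open>The obstacle is that the ring, its function field and the valuation are given by
  quotients and definite descriptions. Once the Hibi ideal is known to be exactly the kernel of the
  toric map, the homogeneous components embed into the polynomial ring in the t_i and their
  fractions into its field of fractions, where all identities can be checked. The variable t_0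
  carries the degree. The generator belonging to \<open>c_j\<close> becomes the monomial t_1 ...
  t_j, because the ideal of \<open>c_j\<close> consists of the first j roots. Monomials in these
  generators therefore have nonincreasing exponent sequences, and each such sequence arises exactly
  once. The uniqueness excludes cancellation, so a minimum over monomials in the generators is a
  minimum over exponents of the t_i. The restriction to nonincreasing sequences is why a general
  element must be rewritten as a quotient before its value can be read off. The reverse
  lexicographic order enters only as a total order compatible with addition, and the chain only
  through the numbering of the roots.\<close>

definition order_ideals :: "'a set \<Rightarrow> ('a \<Rightarrow> 'a \<Rightarrow> bool) \<Rightarrow> 'a set set" where
  "order_ideals A R = {S. S \<subseteq> A \<and> (\<forall>a\<in>A. \<forall>b\<in>S. R a b \<longrightarrow> a \<in> S)}"

text \<open>
  The root \<open>(i, j)\<close> stands for the join-irreducible whose entries from position \<open>i\<close> on exceed those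
  of the minimal element by \<open>n - j\<close>; it lies below \<open>l\<close> iff the \<open>i\<close>-th entry of \<open>l\<close>, in list indexing
  \<open>l ! (i - 1)\<close>, is at least \<open>i + n - j\<close>.
\<close>
definition spec_roots :: "nat \<Rightarrow> nat \<Rightarrow> nat list \<Rightarrow> (nat \<times> nat) set" where
  "spec_roots d n l = {(i, j) \<in> root_poset d n. i + n \<le> l ! (i - 1) + j}"

lemma finite_root_poset: "finite (root_poset d n)"
  by (rule finite_subset[of _ "{..d} \<times> {..n}"]) (auto simp: root_poset_def)

lemma root_poset_eq: "root_poset d n = {1..d} \<times> {d..n-1}"
  by (auto simp: root_poset_def)

lemma card_root_poset:
  assumes "1 \<le> d" "d \<le> n"
  shows "card (root_poset d n) = chain_rank d n"
  using assms by (simp add: root_poset_eq chain_rank_def card_cartesian_product)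

lemma root_le_refl: "root_le r r"
  by (cases r) (simp add: root_le_def)

lemma root_le_trans: "root_le r s \<Longrightarrow> root_le s t \<Longrightarrow> root_le r t"
  by (cases r; cases s; cases t) (simp add: root_le_def)

lemma root_le_antisym: "root_le r s \<Longrightarrow> root_le s r \<Longrightarrow> r = s"
  by (cases r; cases s) (simp add: root_le_def)

text \<open>The index sum decreases strictly upwards in the poset. Minimising it over a finite set
  of roots yields a maximal root, maximising it a minimal one; both are used below.\<close>

lemma root_le_sum: "root_le r s \<Longrightarrow> r \<noteq> s \<Longrightarrow> fst s + snd s < fst r + snd r"
  by (cases r; cases s) (auto simp: root_le_def)

section \<open>Lattice elements as order ideals of the root poset\<close>

lemma mem_grassmann_lattice_iff:
  "l \<in> grassmann_lattice d n \<longleftrightarrow>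
     length l = d \<and> (\<forall>s t. s < t \<longrightarrow> t < d \<longrightarrow> l ! s < l ! t) \<and> (\<forall>t<d. 1 \<le> l ! t \<and> l ! t \<le> n)"
  by (auto simp: grassmann_lattice_def sorted_wrt_iff_nth_less set_conv_nth subset_iff)

lemma grassmann_nth_gap:
  assumes "l \<in> grassmann_lattice d n" "s + k < d"
  shows "l ! s + k \<le> l ! (s + k)"
  using assms(2)
proof (induction k)
  case (Suc k)
  then have "l ! (s + k) < l ! (s + Suc k)"
    using assms(1) unfolding mem_grassmann_lattice_iff by auto
  with Suc show ?case by auto
qed auto

lemma grassmann_nth_ge:
  assumes "l \<in> grassmann_lattice d n" "t < d"
  shows "t + 1 \<le> l ! t"
proof -
  have "1 \<le> l ! 0" using assms unfolding mem_grassmann_lattice_iff by auto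
  then show ?thesis using grassmann_nth_gap[OF assms(1), of 0 t] assms(2) by simp
qed

lemma grassmann_nth_le:
  assumes "l \<in> grassmann_lattice d n" "t < d"
  shows "l ! t + d \<le> n + t + 1"
proof -
  have "l ! (d - 1) \<le> n" using assms unfolding mem_grassmann_lattice_iff by auto
  then show ?thesis using grassmann_nth_gap[OF assms(1), of t "d - 1 - t"] assms(2) by simp
qed

lemma lat_le_iff_nth:
  assumes "l \<in> grassmann_lattice d n" "l' \<in> grassmann_lattice d n"
  shows "lat_le l l' \<longleftrightarrow> (\<forall>t<d. l ! t \<le> l' ! t)"
  using assms by (auto simp: lat_le_def list_all2_conv_all_nth mem_grassmann_lattice_iff)

lemma lat_le_iff_spec_roots:
  assumes "l \<in> grassmann_lattice d n" "l' \<in> grassmann_lattice d n"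
  shows "lat_le l l' \<longleftrightarrow> spec_roots d n l \<subseteq> spec_roots d n l'"
proof
  assume "lat_le l l'"
  then have le: "\<forall>t<d. l ! t \<le> l' ! t"
    using assms by (simp add: lat_le_iff_nth)
  have "i + n \<le> l' ! (i - 1) + j" if "(i, j) \<in> root_poset d n" "i + n \<le> l ! (i - 1) + j" for i j
  proof -
    have "i - 1 < d" using that(1) by (auto simp: root_poset_def)
    then show ?thesis using le that(2) by (meson add_le_mono1 le_trans)
  qed
  then show "spec_roots d n l \<subseteq> spec_roots d n l'"
    by (auto simp: spec_roots_def)
next
  assume sub: "spec_roots d n l \<subseteq> spec_roots d n l'"
  have "l ! t \<le> l' ! t" if t: "t < d" for t
  proof (cases "l ! t = t + 1")
    case True
    then show ?thesis using grassmann_nth_ge[OF assms(2) t] by simp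
  next
    case False
    \<comment> \<open>The root used below is the one of smallest second index in row t + 1 of the
      ideal of \<open>l\<close>. These bounds put it into the poset; the row is nonempty because the
      entry exceeds its least possible value t + 1.\<close>
    have b: "t + 2 \<le> l ! t" "l ! t + d \<le> n + t + 1"
      using False grassmann_nth_ge[OF assms(1) t] grassmann_nth_le[OF assms(1) t] by auto
    then have "(t + 1, t + 1 + n - l ! t) \<in> spec_roots d n l"
      using t by (auto simp: spec_roots_def root_poset_def)
    then have "(t + 1, t + 1 + n - l ! t) \<in> spec_roots d n l'"
      using sub by blast
    then show ?thesis using b by (auto simp: spec_roots_def)
  qed
  then show "lat_le l l'" using assms by (simp add: lat_le_iff_nth)
qed

lemma inj_on_spec_roots: "inj_on (spec_roots d n) (grassmann_lattice d n)"
proof (rule inj_onI)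
  fix l l' assume ll: "l \<in> grassmann_lattice d n" "l' \<in> grassmann_lattice d n"
    and "spec_roots d n l = spec_roots d n l'"
  then have "lat_le l l'" "lat_le l' l" by (auto simp: lat_le_iff_spec_roots)
  then show "l = l'"
    using ll by (auto simp: lat_le_iff_nth mem_grassmann_lattice_iff intro!: nth_equalityI order_antisym)
qed

text \<open>Going from row i to row i' raises the threshold by at most i' - i, and the entry of a
  strictly increasing list grows by at least that much.\<close>

lemma spec_roots_ideal:
  assumes "l \<in> grassmann_lattice d n"
  shows "spec_roots d n l \<in> order_ideals (root_poset d n) root_le"
proof -
  have "(i', j') \<in> spec_roots d n l"
    if r: "(i', j') \<in> root_poset d n" and s: "(i, j) \<in> spec_roots d n l" and "i \<le> i'" "j \<le> j'" for i j i' j'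
  proof -
    have "l ! (i - 1) + (i' - i) \<le> l ! (i' - 1)"
      using grassmann_nth_gap[OF assms, of "i - 1" "i' - i"] that
      by (auto simp: root_poset_def spec_roots_def)
    then show ?thesis using that by (auto simp: spec_roots_def)
  qed
  then show ?thesis by (auto simp: order_ideals_def root_le_def spec_roots_def)
qed

text \<open>The entries of the element belonging to an ideal \<open>S\<close> are read off the row lengths of \<open>S\<close>.\<close>
lemma spec_roots_image:
  assumes "1 \<le> d" "d \<le> n"
  shows "spec_roots d n ` grassmann_lattice d n = order_ideals (root_poset d n) root_le"
proof (intro equalityI subsetI)
  fix S assume S: "S \<in> order_ideals (root_poset d n) root_le"
  define U where "U i = {j. (i, j) \<in> S}" for i
  have SD: "S \<subseteq> root_poset d n" using S by (simp add: order_ideals_def)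
  have dn: "(i', j') \<in> S" if "(i, j) \<in> S" "(i', j') \<in> root_poset d n" "i \<le> i'" "j \<le> j'" for i j i' j'
    using S that by (force simp: order_ideals_def root_le_def)
  have UD: "U i \<subseteq> {d..n-1}" for i
    using SD by (auto simp: U_def root_poset_def)
  have fin: "finite (U i)" for i using UD by (rule finite_subset) simp
  have cardU: "card (U i) \<le> n - d" for i
    using card_mono[OF _ UD, of i] assms by simp
  have mono: "U i \<subseteq> U (i + 1)" if "i < d" "0 < i" for i
  proof
    fix j assume "j \<in> U i"
    then show "j \<in> U (i + 1)"
      using dn[of i j "i + 1" j] SD that by (auto simp: U_def root_poset_def)
  qed
  \<comment> \<open>Each row of an ideal is a final segment of \<open>{d..n-1}\<close>, so its
    length decides membership.\<close>
  have memU: "(i, j) \<in> S \<longleftrightarrow> n \<le> card (U i) + j" if r: "(i, j) \<in> root_poset d n" for i j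
  proof
    assume s: "(i, j) \<in> S"
    have "{j..n-1} \<subseteq> U i"
      using dn[OF s] r by (auto simp: U_def root_poset_def)
    from card_mono[OF fin this] show "n \<le> card (U i) + j"
      using r by (auto simp: root_poset_def)
  next
    assume le: "n \<le> card (U i) + j"
    show "(i, j) \<in> S"
    proof (rule ccontr)
      assume ns: "(i, j) \<notin> S"
      have "j < j'" if "j' \<in> U i" for j'
        using ns dn[of i j' i j] r that by (force simp: U_def not_less)
      then have "U i \<subseteq> {j<..n-1}" using UD[of i] by auto
      from card_mono[OF _ this] have "card (U i) \<le> n - 1 - j" by simp
      then show False using le r by (auto simp: root_poset_def)
    qed
  qed
  \<comment> \<open>The minimal element plus the row lengths. Rows do not get shorter as i grows, so
    the entries increase strictly; a row has at most n - d roots, so they stay at most n.\<close>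
  define l where "l = map (\<lambda>t. t + 1 + card (U (t + 1))) [0..<d]"
  have nth: "l ! t = t + 1 + card (U (t + 1))" if "t < d" for t
    using that by (simp add: l_def)
  have step: "l ! t < l ! Suc t" if "Suc t < d" for t
    using card_mono[OF fin mono[of "t + 1"]] that by (simp add: nth)
  have lt: "l ! s < l ! t" if "s < t" "t < d" for s t
    using that by (induction t) (auto simp: less_Suc_eq intro: step less_trans)
  have lL: "l \<in> grassmann_lattice d n"
    unfolding mem_grassmann_lattice_iff
  proof (intro conjI allI impI)
    fix t assume t: "t < d"
    show "1 \<le> l ! t" using t by (simp add: nth)
    show "l ! t \<le> n" using t cardU[of "t + 1"] assms by (simp add: nth)
  qed (auto simp: lt, simp add: l_def)
  have "S = spec_roots d n l"
  proof (rule Set.set_eqI)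
    fix r :: "nat \<times> nat" obtain i j where r: "r = (i, j)" by (cases r)
    show "r \<in> S \<longleftrightarrow> r \<in> spec_roots d n l"
    proof (cases "r \<in> root_poset d n")
      case True
      then have i: "i - 1 < d" "i \<ge> 1" by (auto simp: r root_poset_def)
      have "l ! (i - 1) = i + card (U i)" using nth[OF i(1)] i(2) by simp
      then show ?thesis using True memU[of i j] by (auto simp: r spec_roots_def)
    qed (use SD in \<open>auto simp: r spec_roots_def\<close>)
  qed
  then show "S \<in> spec_roots d n ` grassmann_lattice d n" using lL by blast
qed (auto simp: spec_roots_ideal)

text \<open>Membership of a root is a lower bound on a single entry, so minimum and maximum of
  entries turn into intersection and union.\<close>

lemma
  assumes "l \<in> grassmann_lattice d n" "l' \<in> grassmann_lattice d n"
  shows lat_meet_closed: "lat_meet l l' \<in> grassmann_lattice d n"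
    and lat_join_closed: "lat_join l l' \<in> grassmann_lattice d n"
    and spec_roots_meet: "spec_roots d n (lat_meet l l') = spec_roots d n l \<inter> spec_roots d n l'"
    and spec_roots_join: "spec_roots d n (lat_join l l') = spec_roots d n l \<union> spec_roots d n l'"
proof -
  have len: "length l = d" "length l' = d"
    using assms by (auto simp: mem_grassmann_lattice_iff)
  have m: "lat_meet l l' ! t = min (l ! t) (l' ! t)" and j: "lat_join l l' ! t = max (l ! t) (l' ! t)"
    if "t < d" for t using that len by (auto simp: lat_meet_def lat_join_def)
  have strict: "l ! s < l ! t" "l' ! s < l' ! t" if "s < t" "t < d" for s t
    using assms that unfolding mem_grassmann_lattice_iff by blast+
  have bounds: "1 \<le> l ! t \<and> l ! t \<le> n" "1 \<le> l' ! t \<and> l' ! t \<le> n" if "t < d" for t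
    using assms that unfolding mem_grassmann_lattice_iff by blast+
  have "lat_meet l l' ! s < lat_meet l l' ! t" "lat_join l l' ! s < lat_join l l' ! t"
    if "s < t" "t < d" for s t
    using strict[OF that] that by (auto simp: m j min_def max_def)
  moreover have "1 \<le> lat_meet l l' ! t \<and> lat_meet l l' ! t \<le> n" "1 \<le> lat_join l l' ! t \<and> lat_join l l' ! t \<le> n"
    if "t < d" for t using bounds[OF that] that by (auto simp: m j)
  moreover have "length (lat_meet l l') = d" "length (lat_join l l') = d"
    using len by (auto simp: lat_meet_def lat_join_def)
  ultimately show "lat_meet l l' \<in> grassmann_lattice d n" "lat_join l l' \<in> grassmann_lattice d n"
    by (auto simp: mem_grassmann_lattice_iff)
  have idx: "i - 1 < d" if "(i, k) \<in> root_poset d n" for i k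
    using that by (auto simp: root_poset_def)
  show "spec_roots d n (lat_meet l l') = spec_roots d n l \<inter> spec_roots d n l'"
    using idx by (auto simp: spec_roots_def m min_def split: if_splits)
  show "spec_roots d n (lat_join l l') = spec_roots d n l \<union> spec_roots d n l'"
    using idx by (auto simp: spec_roots_def j max_def split: if_splits)
qed

lemma lat_bot_closed: "d \<le> n \<Longrightarrow> lat_bot d \<in> grassmann_lattice d n"
  by (auto simp: lat_bot_def mem_grassmann_lattice_iff simp del: upt_Suc)

lemma spec_roots_lat_bot: "spec_roots d n (lat_bot d) = {}"
  by (auto simp: lat_bot_def spec_roots_def root_poset_def simp del: upt_Suc)

section \<open>Join-irreducibles as principal ideals\<close>

definition principal_elem :: "nat \<Rightarrow> nat \<Rightarrow> nat \<times> nat \<Rightarrow> nat list" where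
  "principal_elem d n r =
     the_inv_into (grassmann_lattice d n) (spec_roots d n) {a \<in> root_poset d n. root_le a r}"

locale grassmannian =
  fixes d n :: nat
  assumes d_pos: "1 \<le> d" and d_le: "d \<le> n"
begin

abbreviation "L \<equiv> grassmann_lattice d n"
abbreviation "\<Phi> \<equiv> root_poset d n"
abbreviation "S \<equiv> spec_roots d n"
abbreviation "N \<equiv> chain_rank d n"
abbreviation "pelem \<equiv> principal_elem d n"

lemma finite_spec_roots: "finite (S l)"
  by (rule finite_subset[OF _ finite_root_poset]) (auto simp: spec_roots_def)

lemma ideal_lift:
  assumes "T \<in> order_ideals \<Phi> root_le"
  obtains l where "l \<in> L" "S l = T"
  using assms spec_roots_image[OF d_pos d_le] by (metis imageE)

lemma principal_elem:
  shows "pelem r \<in> L" and "S (pelem r) = {a \<in> \<Phi>. root_le a r}"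
proof -
  have "{a \<in> \<Phi>. root_le a r} \<in> order_ideals \<Phi> root_le"
    by (auto simp: order_ideals_def intro: root_le_trans)
  then have "{a \<in> \<Phi>. root_le a r} \<in> S ` L"
    using spec_roots_image[OF d_pos d_le] by blast
  then show "pelem r \<in> L" "S (pelem r) = {a \<in> \<Phi>. root_le a r}"
    unfolding principal_elem_def
    using the_inv_into_into[OF inj_on_spec_roots _ subset_refl] f_the_inv_into_f[OF inj_on_spec_roots]
    by blast+
qed

lemma principal_elem_le_iff:
  assumes "l \<in> L" "r \<in> \<Phi>"
  shows "lat_le (pelem r) l \<longleftrightarrow> r \<in> S l"
proof -
  have S: "S l \<in> order_ideals \<Phi> root_le" using assms(1) by (rule spec_roots_ideal)
  have "lat_le (pelem r) l \<longleftrightarrow> {a \<in> \<Phi>. root_le a r} \<subseteq> S l"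
    using lat_le_iff_spec_roots[OF principal_elem(1) assms(1)] by (simp add: principal_elem(2))
  also have "\<dots> \<longleftrightarrow> r \<in> S l"
    using S assms(2) root_le_refl[of r] by (auto simp: order_ideals_def)
  finally show ?thesis .
qed

lemma inj_on_principal_elem: "inj_on pelem \<Phi>"
proof (rule inj_onI)
  fix r s assume "r \<in> \<Phi>" "s \<in> \<Phi>" "pelem r = pelem s"
  then have "{a \<in> \<Phi>. root_le a r} = {a \<in> \<Phi>. root_le a s}"
    by (metis principal_elem(2))
  then show "r = s" using \<open>r \<in> \<Phi>\<close> \<open>s \<in> \<Phi>\<close> by (blast intro: root_le_refl root_le_antisym)
qed

lemma principal_elem_neq_bot: "r \<in> \<Phi> \<Longrightarrow> pelem r \<noteq> lat_bot d"
  using principal_elem(2)[of r] root_le_refl[of r] spec_roots_lat_bot[of d n] by auto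

text \<open>Removing a maximal root r from the nonempty ideal of m leaves an ideal, and m is the
  join of the corresponding element with \<open>pelem r\<close>; irreducibility forces
  \<open>m = pelem r\<close>. Conversely, a principal ideal contained in a union lies in the part
  that contains its generator.\<close>

lemma join_irreducibles_eq: "join_irreducibles d n = insert (lat_bot d) (pelem ` \<Phi>)"
proof (intro equalityI subsetI)
  fix m assume m: "m \<in> join_irreducibles d n"
  then have mL: "m \<in> L" by (simp add: join_irreducibles_def)
  show "m \<in> insert (lat_bot d) (pelem ` \<Phi>)"
  proof (cases "S m = {}")
    case True
    then show ?thesis
      using inj_onD[OF inj_on_spec_roots _ mL lat_bot_closed[OF d_le]] by (simp add: spec_roots_lat_bot)
  next
    case False
    \<comment> \<open>Least index sum, hence a maximal root of the ideal.\<close>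
    obtain r where r: "r \<in> S m" and r_min: "\<forall>s\<in>S m. fst r + snd r \<le> fst s + snd s"
      using ex_min_if_finite[of "(\<lambda>r. fst r + snd r) ` S m"] False finite_spec_roots
      by (force simp: not_less)
    have Sm: "S m \<in> order_ideals \<Phi> root_le" using mL by (rule spec_roots_ideal)
    have rD: "r \<in> \<Phi>" using r by (auto simp: spec_roots_def)
    have "S m - {r} \<in> order_ideals \<Phi> root_le"
    proof -
      have "\<not> root_le r b" if "b \<in> S m" "b \<noteq> r" for b
        using root_le_sum[of r b] r_min that by fastforce
      then show ?thesis using Sm by (auto simp: order_ideals_def)
    qed
    then obtain l where l: "l \<in> L" "S l = S m - {r}" by (rule ideal_lift)
    have sub: "S (pelem r) \<subseteq> S m"
      using principal_elem_le_iff[OF mL rD] r lat_le_iff_spec_roots[OF principal_elem(1) mL] by blast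
    have "r \<in> S (pelem r)" using rD by (simp add: principal_elem root_le_refl)
    then have "S m = S (lat_join (pelem r) l)"
      using sub r by (auto simp: spec_roots_join[OF principal_elem(1) l(1)] l(2))
    then have "m = lat_join (pelem r) l"
      by (rule inj_onD[OF inj_on_spec_roots _ mL lat_join_closed[OF principal_elem(1) l(1)]])
    then have "m = pelem r \<or> m = l"
      using m l(1) principal_elem(1) by (auto simp: join_irreducibles_def)
    then show ?thesis using l(2) r rD by auto
  qed
next
  fix m assume m: "m \<in> insert (lat_bot d) (pelem ` \<Phi>)"
  then have mL: "m \<in> L" using lat_bot_closed[OF d_le] principal_elem(1) by auto
  have "m = l \<or> m = l'" if l: "l \<in> L" "l' \<in> L" and eq: "m = lat_join l l'" for l l'
  proof -
    have Sm: "S m = S l \<union> S l'" using eq spec_roots_join[OF l] by simp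
    have "S m = S l \<or> S m = S l'"
    proof (cases "m = lat_bot d")
      case True
      then show ?thesis using Sm by (simp add: spec_roots_lat_bot)
    next
      case False
      then obtain r where r: "r \<in> \<Phi>" "m = pelem r" using m by auto
      then have "r \<in> S m" by (simp add: principal_elem root_le_refl)
      then have "r \<in> S l \<or> r \<in> S l'" using Sm by auto
      then have "S m \<subseteq> S l \<or> S m \<subseteq> S l'"
        using principal_elem_le_iff[OF l(1) r(1)] principal_elem_le_iff[OF l(2) r(1)]
          lat_le_iff_spec_roots[OF mL l(1)] lat_le_iff_spec_roots[OF mL l(2)] r(2) by blast
      then show ?thesis using Sm by auto
    qed
    then show ?thesis using inj_onD[OF inj_on_spec_roots _ mL] l by blast
  qed
  then show "m \<in> join_irreducibles d n" using mL by (auto simp: join_irreducibles_def)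
qed

lemma lat_Spec_eq:
  assumes "l \<in> L"
  shows "lat_Spec d n l = insert (lat_bot d) (pelem ` S l)"
proof -
  have "lat_le (lat_bot d) l"
    using assms by (simp add: lat_le_iff_spec_roots[OF lat_bot_closed[OF d_le]] spec_roots_lat_bot)
  moreover have "S l \<subseteq> \<Phi>" by (auto simp: spec_roots_def)
  ultimately show ?thesis
    using assms by (auto simp: lat_Spec_def join_irreducibles_eq principal_elem_le_iff)
qed

end

section \<open>A maximal chain as an enumeration of the roots\<close>

locale grassmannian_chain = grassmannian +
  fixes C :: "nat list set"
  assumes C_maximal: "C \<in> maximal_chains d n"
begin

lemma C_subset: "C \<subseteq> L"
  and C_comparable: "b \<in> C \<Longrightarrow> c \<in> C \<Longrightarrow> S b \<subseteq> S c \<or> S c \<subseteq> S b"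
proof -
  have ch: "pred_on.chain L lat_le C"
    using C_maximal by (simp add: maximal_chains_def pred_on.maxchain_def)
  then show sub: "C \<subseteq> L" by (simp add: pred_on.chain_def)
  show "S b \<subseteq> S c \<or> S c \<subseteq> S b" if "b \<in> C" "c \<in> C"
  proof -
    have "b \<in> L" "c \<in> L" using that sub by auto
    moreover have "lat_le b c \<or> lat_le c b"
      using pred_on.chain_total[OF ch that] calculation by (auto simp: lat_le_iff_spec_roots)
    ultimately show ?thesis by (simp add: lat_le_iff_spec_roots)
  qed
qed

text \<open>This is maximality in usable form: the element of an ideal comparable with the whole
  chain could be added to it, so it is already there.\<close>

lemma C_complete:
  assumes T: "T \<in> order_ideals \<Phi> root_le" and cmp: "\<And>c. c \<in> C \<Longrightarrow> T \<subseteq> S c \<or> S c \<subseteq> T"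
  obtains c where "c \<in> C" "S c = T"
proof -
  obtain z where z: "z \<in> L" "S z = T" using T by (rule ideal_lift)
  have ch: "pred_on.chain L lat_le C" and mx: "\<And>D. pred_on.chain L lat_le D \<Longrightarrow> \<not> C \<subset> D"
    using C_maximal by (auto simp: maximal_chains_def pred_on.maxchain_def)
  have le: "lat_le z c \<or> lat_le c z" if "c \<in> C" for c
  proof -
    have "c \<in> L" using that C_subset by blast
    then show ?thesis using cmp[OF that] z by (simp add: lat_le_iff_spec_roots)
  qed
  have "lat_le z z" using z(1) by (simp add: lat_le_iff_spec_roots)
  then have "pred_on.chain L lat_le (insert z C)"
    using ch z(1) le by (auto simp: pred_on.chain_def)
  then have "z \<in> C" using mx by blast
  then show thesis using z that by blast
qed

lemma C_rank_inj: "b \<in> C \<Longrightarrow> c \<in> C \<Longrightarrow> card (S b) = card (S c) \<Longrightarrow> b = c"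
  using C_comparable[of b c] C_subset inj_onD[OF inj_on_spec_roots]
  by (metis card_subset_eq finite_spec_roots subsetD)

lemma C_rank_le: "b \<in> C \<Longrightarrow> c \<in> C \<Longrightarrow> card (S b) \<le> card (S c) \<longleftrightarrow> S b \<subseteq> S c"
  using C_comparable[of b c]
  by (metis card_mono card_seteq finite_spec_roots)

text \<open>The chain skips no rank. Let c have rank k and let c' be the next chain element. A
  minimal root of the difference of their ideals extends the ideal of c to an ideal inside that of
  c'. It is comparable with the whole chain, hence belongs to it, and has rank k + 1.\<close>

lemma C_rank_surj:
  assumes "k \<le> N"
  obtains c where "c \<in> C" "card (S c) = k"
proof -
  have "\<exists>c\<in>C. card (S c) = k"
    using assms
  proof (induction k)
    case 0
    obtain c where "c \<in> C" "S c = {}"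
      by (rule C_complete[of "{}"]) (auto simp: order_ideals_def)
    then show ?case by (intro bexI[of _ c]) auto
  next
    case (Suc k)
    then obtain c where c: "c \<in> C" "card (S c) = k" by auto
    define T where "T = {b \<in> C. k < card (S b)}"
    obtain t where t: "t \<in> C" "S t = \<Phi>"
      by (rule C_complete[of \<Phi>]) (auto simp: order_ideals_def spec_roots_def)
    then have "t \<in> T" using Suc.prems card_root_poset[OF d_pos d_le] by (simp add: T_def)
    then obtain c' where c': "c' \<in> T" "\<And>b. b \<in> T \<Longrightarrow> card (S c') \<le> card (S b)"
      using arg_min_natI[of "\<lambda>x. x \<in> T" t "\<lambda>x. card (S x)"]
        arg_min_nat_le[of "\<lambda>x. x \<in> T" _ "\<lambda>x. card (S x)"] by blast
    have c'C: "c' \<in> C" "k < card (S c')" using c' by (auto simp: T_def)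
    have lt: "S c \<subset> S c'" using C_rank_le[OF c(1) c'C(1)] c c'C by auto
    \<comment> \<open>Largest index sum: a root of the difference strictly below r would have a
      larger one.\<close>
    obtain r where r: "r \<in> S c' - S c" and r_max: "\<forall>s\<in>S c' - S c. fst s + snd s \<le> fst r + snd r"
    proof -
      have fin: "finite ((\<lambda>r. fst r + snd r) ` (S c' - S c))" and ne: "S c' - S c \<noteq> {}"
        using lt finite_spec_roots[of c'] by auto
      then obtain r where "r \<in> S c' - S c"
        "fst r + snd r = Max ((\<lambda>r. fst r + snd r) ` (S c' - S c))"
        using Max_in[OF fin] by fastforce
      then show thesis using Max_ge[OF fin] by (intro that[of r]) (auto intro!: image_eqI)
    qed
    have ideals: "S c \<in> order_ideals \<Phi> root_le" "S c' \<in> order_ideals \<Phi> root_le"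
      using c c'C C_subset by (auto intro: spec_roots_ideal)
    have "a \<in> insert r (S c)" if "a \<in> \<Phi>" "root_le a r" for a
    proof (rule ccontr)
      assume a: "a \<notin> insert r (S c)"
      then have "a \<in> S c' - S c" using ideals(2) that r by (auto simp: order_ideals_def)
      then have "fst a + snd a \<le> fst r + snd r" using r_max by blast
      then show False using root_le_sum[OF that(2)] a by auto
    qed
    then have "insert r (S c) \<in> order_ideals \<Phi> root_le"
      using ideals r by (auto simp: order_ideals_def)
    moreover have "insert r (S c) \<subseteq> S b \<or> S b \<subseteq> insert r (S c)" if b: "b \<in> C" for b
    proof (cases "card (S b) \<le> k")
      case True
      then show ?thesis using C_rank_le[OF b c(1)] c by auto
    next
      case False
      then have "S c' \<subseteq> S b" using c'(2)[of b] C_rank_le[OF c'C(1) b] b by (simp add: T_def)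
      then show ?thesis using r lt by auto
    qed
    ultimately obtain b where "b \<in> C" "S b = insert r (S c)" by (rule C_complete)
    then show ?case using c r finite_spec_roots by (intro bexI[of _ b]) auto
  qed
  then show thesis using that by blast
qed

lemma card_spec_roots_le: "card (S l) \<le> N"
  unfolding card_root_poset[OF d_pos d_le, symmetric]
  by (rule card_mono[OF finite_root_poset]) (auto simp: spec_roots_def)

text \<open>\<open>chain_elem\<close> counts predecessors inside the chain. As the chain realises
  every rank, this count agrees with the size of the ideal, which is the measure used everywhere
  else.\<close>

lemma rank_bij_betw:
  assumes "c \<in> C"
  shows "bij_betw (\<lambda>b. card (S b)) {b \<in> C. lat_le b c \<and> b \<noteq> c} {..<card (S c)}"
  unfolding bij_betw_def
proof
  show "inj_on (\<lambda>b. card (S b)) {b \<in> C. lat_le b c \<and> b \<noteq> c}"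
    by (rule inj_onI) (auto intro: C_rank_inj)
  have le: "lat_le b c \<longleftrightarrow> card (S b) \<le> card (S c)" if "b \<in> C" for b
    using C_rank_le[OF that assms] lat_le_iff_spec_roots[of b d n c] that assms C_subset by blast
  show "(\<lambda>b. card (S b)) ` {b \<in> C. lat_le b c \<and> b \<noteq> c} = {..<card (S c)}"
  proof (intro equalityI subsetI)
    fix k assume k: "k \<in> {..<card (S c)}"
    then obtain b where "b \<in> C" "card (S b) = k"
      using C_rank_surj[of k] card_spec_roots_le[of c] by auto
    then show "k \<in> (\<lambda>b. card (S b)) ` {b \<in> C. lat_le b c \<and> b \<noteq> c}" using k le by force
  qed (use le assms C_rank_inj in \<open>force simp: order_less_le\<close>)
qed

lemma chain_elem:
  assumes "k \<le> N"
  shows "chain_elem C k \<in> C" and "card (S (chain_elem C k)) = k"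
proof -
  obtain c where c: "c \<in> C" "card (S c) = k" using assms by (rule C_rank_surj)
  have card: "card {b \<in> C. lat_le b c \<and> b \<noteq> c} = card (S c)" if "c \<in> C" for c
    using bij_betw_same_card[OF rank_bij_betw[OF that]] by simp
  have "chain_elem C k = c"
    unfolding chain_elem_def
    by (rule the_equality) (use c card in \<open>auto intro!: C_rank_inj\<close>)
  then show "chain_elem C k \<in> C" "card (S (chain_elem C k)) = k" using c by auto
qed

lemma chain_elem_closed: "k \<le> N \<Longrightarrow> chain_elem C k \<in> L"
  using chain_elem(1) C_subset by blast

lemma S_chain_elem_mono: "k \<le> k' \<Longrightarrow> k' \<le> N \<Longrightarrow> S (chain_elem C k) \<subseteq> S (chain_elem C k')"
  using C_rank_le[OF chain_elem(1)[of k] chain_elem(1)[of k']] by (simp add: chain_elem(2))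

definition root_enum :: "nat \<Rightarrow> nat \<times> nat" where
  "root_enum i = (THE r. r \<in> S (chain_elem C i) - S (chain_elem C (i - 1)))"

lemma S_chain_elem_diff:
  assumes "i \<in> {1..N}"
  shows "S (chain_elem C i) - S (chain_elem C (i - 1)) = {root_enum i}"
proof -
  have "card (S (chain_elem C i) - S (chain_elem C (i - 1))) = 1"
    using assms S_chain_elem_mono[of "i - 1" i]
    by (subst card_Diff_subset) (auto simp: finite_spec_roots chain_elem(2))
  then obtain r where "S (chain_elem C i) - S (chain_elem C (i - 1)) = {r}"
    by (auto simp: card_1_singleton_iff)
  then show ?thesis unfolding root_enum_def by simp
qed

text \<open>Ideals only grow along the chain, so the ideal of the k-th element consists of the first
  k roots. All later computations with the chain rest on this.\<close>

lemma root_enum_mem_iff: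
  assumes "i \<in> {1..N}" "k \<le> N"
  shows "root_enum i \<in> S (chain_elem C k) \<longleftrightarrow> i \<le> k"
proof
  assume m: "root_enum i \<in> S (chain_elem C k)"
  show "i \<le> k"
  proof (rule ccontr)
    assume "\<not> i \<le> k"
    then have "S (chain_elem C k) \<subseteq> S (chain_elem C (i - 1))"
      using assms by (intro S_chain_elem_mono) auto
    then show False using m S_chain_elem_diff[OF assms(1)] by blast
  qed
next
  assume "i \<le> k"
  then show "root_enum i \<in> S (chain_elem C k)"
    using S_chain_elem_mono[of i k] S_chain_elem_diff[OF assms(1)] assms by blast
qed

lemma bij_betw_root_enum: "bij_betw root_enum {1..N} \<Phi>"
proof -
  have inj: "inj_on root_enum {1..N}"
    using root_enum_mem_iff by (intro inj_onI) (metis atLeastAtMost_iff order_antisym order_refl)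
  have sub: "root_enum ` {1..N} \<subseteq> \<Phi>"
  proof
    fix r assume "r \<in> root_enum ` {1..N}"
    then obtain i where i: "i \<in> {1..N}" "r = root_enum i" by blast
    then have "r \<in> S (chain_elem C i)" using S_chain_elem_diff[OF i(1)] by blast
    then show "r \<in> \<Phi>" by (auto simp: spec_roots_def)
  qed
  have "root_enum ` {1..N} = \<Phi>"
    by (rule card_subset_eq[OF finite_root_poset sub])
      (simp add: card_image[OF inj] card_root_poset[OF d_pos d_le] del: One_nat_def)
  then show ?thesis using inj by (simp add: bij_betw_def)
qed

lemma root_enum_in_roots: "i \<in> {1..N} \<Longrightarrow> root_enum i \<in> \<Phi>"
  using bij_betwE[OF bij_betw_root_enum] by blast

lemma irr_enum_eq:
  assumes "i \<in> {1..N}"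
  shows "irr_enum d n C i = pelem (root_enum i)"
proof -
  have sub: "S l \<subseteq> \<Phi>" for l by (auto simp: spec_roots_def)
  have nb: "lat_bot d \<notin> pelem ` S l" for l
    using principal_elem_neq_bot sub by (metis imageE subsetD)
  have "lat_Spec d n (chain_elem C i) - lat_Spec d n (chain_elem C (i - 1))
      = pelem ` (S (chain_elem C i) - S (chain_elem C (i - 1)))"
  proof -
    have "pelem ` (S (chain_elem C i) - S (chain_elem C (i - 1)))
        = pelem ` S (chain_elem C i) - pelem ` S (chain_elem C (i - 1))"
      using sub by (intro inj_on_image_set_diff[OF inj_on_principal_elem]) auto
    moreover have "chain_elem C i \<in> L" "chain_elem C (i - 1) \<in> L"
      using assms by (auto intro!: chain_elem_closed)
    ultimately show ?thesis using nb by (simp add: lat_Spec_eq insert_Diff_if)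
  qed
  also have "\<dots> = {pelem (root_enum i)}" using S_chain_elem_diff[OF assms] by simp
  finally show ?thesis using assms by (simp add: irr_enum_def)
qed

lemma Spec_weight_eq:
  assumes "l \<in> L"
  shows "Spec_weight d n C l i = of_bool (i \<in> {1..N} \<and> root_enum i \<in> S l)"
proof (cases "i \<in> {1..N}")
  case True
  have sub: "S l \<subseteq> \<Phi>" by (auto simp: spec_roots_def)
  have "pelem (root_enum i) \<in> insert (lat_bot d) (pelem ` S l) - {lat_bot d} \<longleftrightarrow> root_enum i \<in> S l"
    using principal_elem_neq_bot[OF root_enum_in_roots[OF True]]
      inj_on_image_mem_iff[OF inj_on_principal_elem root_enum_in_roots[OF True] sub] by blast
  then show ?thesis using True assms
    by (simp add: Spec_weight_def irr_enum_eq lat_Spec_eq)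
next
  case False
  then show ?thesis unfolding Spec_weight_def by (simp only: simp_thms if_False of_bool_eq)
qed

end

section \<open>Push-forward of polynomials along monomial maps\<close>

text \<open>Coefficients of colliding monomials add up. The map f is arbitrary: additive maps give
  ring homomorphisms, but choice functions on exponents, which are not additive in general, are
  pushed along as well.\<close>

definition push_mapping :: "('a \<Rightarrow> 'b) \<Rightarrow> ('a \<Rightarrow>\<^sub>0 'c::comm_monoid_add) \<Rightarrow> 'b \<Rightarrow>\<^sub>0 'c" where
  "push_mapping f p =
     (\<Sum>m\<in>Poly_Mapping.keys p. Poly_Mapping.single (f m) (Poly_Mapping.lookup p m))"

lemma push_mapping_superset:
  assumes "finite A" "Poly_Mapping.keys p \<subseteq> A"
  shows "push_mapping f p = (\<Sum>m\<in>A. Poly_Mapping.single (f m) (Poly_Mapping.lookup p m))"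
  unfolding push_mapping_def
  by (rule sum.mono_neutral_left) (use assms in \<open>auto simp: in_keys_iff\<close>)

lemma push_mapping_zero [simp]: "push_mapping f 0 = 0"
  by (simp add: push_mapping_def)

lemma push_mapping_single [simp]: "push_mapping f (Poly_Mapping.single m c) = Poly_Mapping.single (f m) c"
  by (cases "c = 0") (simp_all add: push_mapping_def)

lemma push_mapping_add: "push_mapping f (p + q) = push_mapping f p + push_mapping f q"
proof -
  let ?A = "Poly_Mapping.keys p \<union> Poly_Mapping.keys q"
  have "push_mapping f r = (\<Sum>m\<in>?A. Poly_Mapping.single (f m) (Poly_Mapping.lookup r m))"
    if "r \<in> {p, q, p + q}" for r
    using that Poly_Mapping.keys_add[of p q] by (intro push_mapping_superset) auto
  then show ?thesis by (simp add: lookup_add single_add sum.distrib)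
qed

lemma push_mapping_sum: "push_mapping f (\<Sum>a\<in>A. p a) = (\<Sum>a\<in>A. push_mapping f (p a))"
  by (induction A rule: infinite_finite_induct) (auto simp: push_mapping_add)

lemma push_mapping_minus:
  fixes p q :: "'a \<Rightarrow>\<^sub>0 'c::ab_group_add"
  shows "push_mapping f (p - q) = push_mapping f p - push_mapping f q"
  using push_mapping_add[of f "p - q" q] by simp

lemma poly_mapping_sum_single:
  "p = (\<Sum>m\<in>Poly_Mapping.keys p. Poly_Mapping.single m (Poly_Mapping.lookup p m))"
  by (rule poly_mapping_eqI)
     (auto simp: lookup_sum lookup_single when_def in_keys_iff)

lemma push_mapping_comp: "push_mapping g (push_mapping f p) = push_mapping (\<lambda>m. g (f m)) p"
  by (simp add: push_mapping_def[of f] push_mapping_sum) (simp add: push_mapping_def)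

lemma push_mapping_mult:
  fixes p q :: "'a::monoid_add \<Rightarrow>\<^sub>0 'c::semiring_0"
  assumes "\<And>a b. f (a + b) = f a + f b"
  shows "push_mapping f (p * q) = push_mapping f p * push_mapping f q"
proof -
  have "push_mapping f (p * q) = push_mapping f
      ((\<Sum>m\<in>Poly_Mapping.keys p. Poly_Mapping.single m (Poly_Mapping.lookup p m)) *
       (\<Sum>m\<in>Poly_Mapping.keys q. Poly_Mapping.single m (Poly_Mapping.lookup q m)))"
    by (simp flip: poly_mapping_sum_single)
  also have "\<dots> = push_mapping f p * push_mapping f q"
    by (simp add: sum_product mult_single push_mapping_sum assms)
       (simp add: push_mapping_def sum_product mult_single)
  finally show ?thesis .
qed

lemma lookup_push_mapping:
  "Poly_Mapping.lookup (push_mapping f p) k =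
     (\<Sum>m\<in>{m \<in> Poly_Mapping.keys p. f m = k}. Poly_Mapping.lookup p m)"
  unfolding push_mapping_def lookup_sum lookup_single when_def
  by (rule sum.inter_filter[symmetric]) simp

lemma keys_push_mapping_subset: "Poly_Mapping.keys (push_mapping f p) \<subseteq> f ` Poly_Mapping.keys p"
proof
  fix k assume "k \<in> Poly_Mapping.keys (push_mapping f p)"
  then have "{m \<in> Poly_Mapping.keys p. f m = k} \<noteq> {}"
    unfolding in_keys_iff lookup_push_mapping by (metis (no_types) sum.empty)
  then show "k \<in> f ` Poly_Mapping.keys p" by auto
qed

lemma lookup_push_mapping_inj:
  assumes "inj_on f (Poly_Mapping.keys p)" "m \<in> Poly_Mapping.keys p"
  shows "Poly_Mapping.lookup (push_mapping f p) (f m) = Poly_Mapping.lookup p m"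
proof -
  have "{m' \<in> Poly_Mapping.keys p. f m' = f m} = {m}"
    using assms by (auto dest: inj_onD)
  then show ?thesis by (simp add: lookup_push_mapping)
qed

lemma keys_push_mapping_inj:
  assumes "inj_on f (Poly_Mapping.keys p)"
  shows "Poly_Mapping.keys (push_mapping f p) = f ` Poly_Mapping.keys p"
  using lookup_push_mapping_inj[OF assms] keys_push_mapping_subset[of f p]
  by (auto simp: in_keys_iff)

text \<open>The exponent after substituting for every variable v the monomial with exponent
  \<open>w v\<close>. It is additive in m, so pushing polynomials along it is a substitution
  homomorphism.\<close>

definition mon_subst :: "('v \<Rightarrow> 'w mon) \<Rightarrow> 'v mon \<Rightarrow> 'w mon" where
  "mon_subst w m = (\<Sum>v\<in>Poly_Mapping.keys m. \<Sum>_<Poly_Mapping.lookup m v. w v)"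

lemma lookup_mon_subst_superset:
  assumes "finite A" "Poly_Mapping.keys m \<subseteq> A"
  shows "Poly_Mapping.lookup (mon_subst w m) i =
           (\<Sum>v\<in>A. Poly_Mapping.lookup m v * Poly_Mapping.lookup (w v) i)"
  unfolding mon_subst_def lookup_sum
  using assms by (auto simp: in_keys_iff intro!: sum.mono_neutral_cong_left)

lemmas lookup_mon_subst = lookup_mon_subst_superset[OF finite_keys subset_refl]

lemma mon_subst_add: "mon_subst w (m + m') = mon_subst w m + mon_subst w m'"
proof (rule poly_mapping_eqI)
  fix i
  let ?A = "Poly_Mapping.keys m \<union> Poly_Mapping.keys m'"
  have "Poly_Mapping.lookup (mon_subst w r) i = (\<Sum>v\<in>?A. Poly_Mapping.lookup r v * Poly_Mapping.lookup (w v) i)"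
    if "r \<in> {m, m', m + m'}" for r
    using that Poly_Mapping.keys_add[of m m'] by (intro lookup_mon_subst_superset) auto
  then show "Poly_Mapping.lookup (mon_subst w (m + m')) i =
      Poly_Mapping.lookup (mon_subst w m + mon_subst w m') i"
    by (simp add: lookup_add sum.distrib add_mult_distrib)
qed

lemma mon_subst_single [simp]: "mon_subst w (Poly_Mapping.single v (Suc 0)) = w v"
  by (rule poly_mapping_eqI) (simp add: lookup_mon_subst)

lemma mon_subst_zero [simp]: "mon_subst w 0 = 0"
  by (simp add: mon_subst_def)

text \<open>A coordinate in which all substituted monomials have exponent 1 counts factors. In the
  toric map coordinate 0 has this role.\<close>

lemma mon_degree_eq_lookup:
  assumes "\<And>v. v \<in> Poly_Mapping.keys m \<Longrightarrow> Poly_Mapping.lookup (w v) i = 1"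
  shows "mon_degree m = Poly_Mapping.lookup (mon_subst w m) i"
  by (simp add: mon_degree_def lookup_mon_subst assms)

lemma mon_degree_superset:
  assumes "finite A" "Poly_Mapping.keys m \<subseteq> A"
  shows "mon_degree m = (\<Sum>v\<in>A. Poly_Mapping.lookup m v)"
  unfolding mon_degree_def
  by (rule sum.mono_neutral_left) (use assms in \<open>auto simp: in_keys_iff\<close>)

lemma mon_degree_add: "mon_degree (m + m') = mon_degree m + mon_degree m'"
proof -
  let ?A = "Poly_Mapping.keys m \<union> Poly_Mapping.keys m'"
  have "mon_degree r = (\<Sum>v\<in>?A. Poly_Mapping.lookup r v)" if "r \<in> {m, m', m + m'}" for r
    using that Poly_Mapping.keys_add[of m m'] by (intro mon_degree_superset) auto
  then show ?thesis by (simp add: lookup_add sum.distrib)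
qed

lemma mon_degree_single [simp]: "mon_degree (Poly_Mapping.single v k) = k"
  by (cases "k = 0") (simp_all add: mon_degree_def)

lemma mon_degree_zero [simp]: "mon_degree 0 = 0"
  by (simp add: mon_degree_def)

lemma mon_degree_eq_0_iff: "mon_degree m = 0 \<longleftrightarrow> m = 0"
  by (auto simp: mon_degree_def in_keys_iff simp flip: keys_eq_empty)

lemma keys_add_mon: "Poly_Mapping.keys (m + m') = Poly_Mapping.keys m \<union> Poly_Mapping.keys (m' :: 'v mon)"
  by (auto simp: in_keys_iff lookup_add)

lemma mon_split:
  fixes m :: "'v mon"
  assumes "v \<in> Poly_Mapping.keys m"
  obtains m' where "m = Poly_Mapping.single v 1 + m'"
proof
  show "m = Poly_Mapping.single v 1 + (m - Poly_Mapping.single v 1)"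
    using assms
    by (intro poly_mapping_eqI)
       (auto simp: lookup_add minus_poly_mapping.rep_eq lookup_single when_def in_keys_iff)
qed

lemma mon_induct [consumes 1, case_names zero add]:
  fixes m :: "'v mon"
  assumes "Poly_Mapping.keys m \<subseteq> V" and "P 0"
    and step: "\<And>v m. v \<in> V \<Longrightarrow> Poly_Mapping.keys m \<subseteq> V \<Longrightarrow> P m \<Longrightarrow> P (Poly_Mapping.single v 1 + m)"
  shows "P m"
  using assms(1)
proof (induction "mon_degree m" arbitrary: m)
  case 0
  then show ?case using assms(2) by (simp add: mon_degree_eq_0_iff)
next
  case (Suc k)
  then have "m \<noteq> 0" by auto
  then obtain v where v: "v \<in> Poly_Mapping.keys m" by (auto simp flip: keys_eq_empty)
  then obtain m' where m': "m = Poly_Mapping.single v 1 + m'" by (rule mon_split)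
  then have "Poly_Mapping.keys m' \<subseteq> V" "mon_degree m' = k"
    using Suc.prems Suc.hyps(2) by (auto simp: keys_add_mon mon_degree_add)
  then show ?case using step[of v m'] Suc.hyps(1)[of m'] v Suc.prems m' by auto
qed


lemma push_mapping_cong:
  "(\<And>m. m \<in> Poly_Mapping.keys p \<Longrightarrow> f m = g m) \<Longrightarrow> push_mapping f p = push_mapping g p"
  unfolding push_mapping_def by (rule sum.cong) auto

lemma push_mapping_shift:
  fixes p :: "'a \<Rightarrow>\<^sub>0 'c::semiring_1"
  shows "push_mapping f p * Poly_Mapping.single c 1 = push_mapping (\<lambda>m. f m + c) p"
  by (simp add: push_mapping_def sum_distrib_right mult_single)

lemma push_mapping_id [simp]: "push_mapping (\<lambda>m. m) p = p"
  by (simp add: push_mapping_def flip: poly_mapping_sum_single)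

lemma prod_single_one:
  "(\<Prod>a\<in>A. Poly_Mapping.single (f a) (1::'c::comm_semiring_1)) = Poly_Mapping.single (\<Sum>a\<in>A. f a) 1"
  by (induction A rule: infinite_finite_induct) (auto simp: mult_single simp flip: single_one)

lemma single_one_power:
  "Poly_Mapping.single a (1::'c::comm_semiring_1) ^ k = Poly_Mapping.single (\<Sum>_<k. a) 1"
  by (induction k) (auto simp: mult_single add.commute simp flip: single_one)

text \<open>Subtraction of natural numbers is truncated, so the telescope needs f to be
  nonincreasing.\<close>

lemma sum_nat_telescope:
  fixes f :: "nat \<Rightarrow> nat"
  assumes "i \<le> Suc n" "\<And>v. i \<le> v \<Longrightarrow> v \<le> n \<Longrightarrow> f (Suc v) \<le> f v"
  shows "(\<Sum>v\<in>{i..n}. f v - f (Suc v)) + f (Suc n) = f i"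
  using assms
proof (induction i rule: inc_induct)
  case (step k)
  have "{k..n} = insert k {Suc k..n}" using step.hyps by auto
  moreover have "f (Suc k) \<le> f k" "(\<Sum>v\<in>{Suc k..n}. f v - f (Suc v)) + f (Suc n) = f (Suc k)"
    using step by auto
  ultimately show ?case by simp
qed simp

section \<open>Degree-zero fractions of a graded ring embedded in a domain\<close>

definition to_fract :: "'a::idom \<Rightarrow> 'a fract" where
  "to_fract x = Fract x 1"

lemma to_fract_simps [simp]:
  "to_fract (x + y) = to_fract x + to_fract y" "to_fract (x * y) = to_fract x * to_fract y"
  "to_fract 0 = 0" "to_fract 1 = 1" "to_fract x = to_fract y \<longleftrightarrow> x = y"
  by (simp_all add: to_fract_def eq_fract fract_collapse)

lemma to_fract_eq_0_iff [simp]: "to_fract x = 0 \<longleftrightarrow> x = 0"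
  using to_fract_simps(5)[of x 0] by (simp del: to_fract_simps(5))

lemma to_fract_sum: "to_fract (\<Sum>a\<in>A. f a) = (\<Sum>a\<in>A. to_fract (f a))"
  by (induction A rule: infinite_finite_induct) auto

lemma to_fract_prod: "to_fract (\<Prod>a\<in>A. f a) = (\<Prod>a\<in>A. to_fract (f a))"
  by (induction A rule: infinite_finite_induct) auto

lemma to_fract_power: "to_fract (x ^ k) = to_fract x ^ k"
  by (induction k) auto

lemma Fract_eq_to_fract: "b \<noteq> 0 \<Longrightarrow> Fract a b = to_fract a / to_fract b"
  by (simp add: to_fract_def)

lemma finprod_transport:
  fixes \<psi> :: "'a \<Rightarrow> 'f::comm_monoid_mult"
  assumes "comm_monoid G" "\<psi> \<one>\<^bsub>G\<^esub> = 1"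
    and "\<And>x y. x \<in> carrier G \<Longrightarrow> y \<in> carrier G \<Longrightarrow> \<psi> (x \<otimes>\<^bsub>G\<^esub> y) = \<psi> x * \<psi> y"
    and "finite A" "\<And>a. a \<in> A \<Longrightarrow> f a \<in> carrier G"
  shows "\<psi> (finprod G f A) = (\<Prod>a\<in>A. \<psi> (f a))"
proof -
  interpret comm_monoid G by fact
  show ?thesis using assms(4,5)
    by (induction A rule: finite_induct) (auto simp: assms Pi_def)
qed

lemma nat_pow_transport:
  fixes \<psi> :: "'a \<Rightarrow> 'f::comm_monoid_mult"
  assumes "comm_monoid G" "\<psi> \<one>\<^bsub>G\<^esub> = 1"
    and "\<And>x y. x \<in> carrier G \<Longrightarrow> y \<in> carrier G \<Longrightarrow> \<psi> (x \<otimes>\<^bsub>G\<^esub> y) = \<psi> x * \<psi> y"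
    and "x \<in> carrier G"
  shows "\<psi> (x [^]\<^bsub>G\<^esub> (k::nat)) = \<psi> x ^ k"
proof -
  interpret comm_monoid G by fact
  show ?thesis by (induction k) (auto simp: assms mult.commute)
qed

lemma finsum_transport:
  fixes \<psi> :: "'a \<Rightarrow> 'f::comm_monoid_add"
  assumes "abelian_monoid G" "\<psi> \<zero>\<^bsub>G\<^esub> = 0"
    and "\<And>x y. x \<in> carrier G \<Longrightarrow> y \<in> carrier G \<Longrightarrow> \<psi> (x \<oplus>\<^bsub>G\<^esub> y) = \<psi> x + \<psi> y"
    and "finite A" "\<And>a. a \<in> A \<Longrightarrow> f a \<in> carrier G"
  shows "\<psi> (finsum G f A) = (\<Sum>a\<in>A. \<psi> (f a))"
proof -
  interpret abelian_monoid G by fact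
  show ?thesis using assms(4,5)
    by (induction A rule: finite_induct) (auto simp: assms Pi_def)
qed

text \<open>The conditions concern homogeneous elements only, because the pairs in
  \<open>frac_field\<close> and the products and sums formed from them stay homogeneous. The
  integral domain in the target supplies the cancellation that makes cross-multiplication an
  equivalence.\<close>

locale graded_embedding =
  fixes R :: "('a, 'm) ring_scheme" (structure) and A :: "nat \<Rightarrow> 'a set" and \<phi> :: "'a \<Rightarrow> 'b::idom"
  assumes inj: "f \<in> A i \<Longrightarrow> g \<in> A i \<Longrightarrow> \<phi> f = \<phi> g \<Longrightarrow> f = g"
    and mult_closed: "f \<in> A i \<Longrightarrow> g \<in> A j \<Longrightarrow> f \<otimes> g \<in> A (i + j)"
    and mult: "f \<in> A i \<Longrightarrow> g \<in> A j \<Longrightarrow> \<phi> (f \<otimes> g) = \<phi> f * \<phi> g"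
    and add_closed: "f \<in> A i \<Longrightarrow> g \<in> A i \<Longrightarrow> f \<oplus> g \<in> A i"
    and add: "f \<in> A i \<Longrightarrow> g \<in> A i \<Longrightarrow> \<phi> (f \<oplus> g) = \<phi> f + \<phi> g"
    and one_closed: "\<one> \<in> A 0" and one: "\<phi> \<one> = 1"
    and zero_closed: "\<zero> \<in> A i" and zero: "\<phi> \<zero> = 0"
begin

abbreviation "K \<equiv> frac_field R A"

text \<open>All pairs in a class have the same quotient in the target, so the image is a
  singleton.\<close>

definition \<psi> :: "('a \<times> 'a) set \<Rightarrow> 'b fract" where
  "\<psi> x = the_elem ((\<lambda>(f, g). Fract (\<phi> f) (\<phi> g)) ` x)"

lemma nonzero: "g \<in> A i - {\<zero>} \<Longrightarrow> \<phi> g \<noteq> 0"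
  using inj[OF _ zero_closed] zero by auto

lemma frac_pairsE:
  assumes "(f, g) \<in> frac_pairs R A"
  obtains i where "f \<in> A i" "g \<in> A i" "g \<noteq> \<zero>" "\<phi> g \<noteq> 0"
  using assms nonzero unfolding frac_pairs_def by blast

lemma frac_pairsI: "f \<in> A i \<Longrightarrow> g \<in> A i \<Longrightarrow> \<phi> g \<noteq> 0 \<Longrightarrow> (f, g) \<in> frac_pairs R A"
  unfolding frac_pairs_def using zero by auto

text \<open>Both cross products lie in degree i + j, and there \<phi> is injective.\<close>

lemma frac_rel_iff:
  "((f, g), (f', g')) \<in> frac_rel R A \<longleftrightarrow>
     (f, g) \<in> frac_pairs R A \<and> (f', g') \<in> frac_pairs R A \<and> Fract (\<phi> f) (\<phi> g) = Fract (\<phi> f') (\<phi> g')"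
proof -
  have "f \<otimes> g' = f' \<otimes> g \<longleftrightarrow> Fract (\<phi> f) (\<phi> g) = Fract (\<phi> f') (\<phi> g')"
    if p: "(f, g) \<in> frac_pairs R A" "(f', g') \<in> frac_pairs R A"
  proof -
    obtain i where i: "f \<in> A i" "g \<in> A i" "\<phi> g \<noteq> 0" using p(1) by (rule frac_pairsE)
    obtain j where j: "f' \<in> A j" "g' \<in> A j" "\<phi> g' \<noteq> 0" using p(2) by (rule frac_pairsE)
    have "f \<otimes> g' = f' \<otimes> g \<longleftrightarrow> \<phi> (f \<otimes> g') = \<phi> (f' \<otimes> g)"
      using inj[of "f \<otimes> g'" "i + j" "f' \<otimes> g"] mult_closed i j by (metis add.commute)
    then show ?thesis using i j by (simp add: mult[OF i(1) j(2)] mult[OF j(1) i(2)] eq_fract)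
  qed
  then show ?thesis unfolding frac_rel_def by auto
qed

lemma hom_frac_eq:
  assumes "(f, g) \<in> frac_pairs R A"
  shows "hom_frac R A f g =
           {(f', g') \<in> frac_pairs R A. Fract (\<phi> f) (\<phi> g) = Fract (\<phi> f') (\<phi> g')}"
  using assms by (auto simp: hom_frac_def frac_rel_iff)

lemma hom_frac_cong:
  assumes "(f, g) \<in> frac_pairs R A" "(f', g') \<in> frac_pairs R A"
    "Fract (\<phi> f) (\<phi> g) = Fract (\<phi> f') (\<phi> g')"
  shows "hom_frac R A f g = hom_frac R A f' g'"
  using assms by (simp add: hom_frac_eq)

lemma \<psi>_hom_frac:
  assumes "(f, g) \<in> frac_pairs R A"
  shows "\<psi> (hom_frac R A f g) = Fract (\<phi> f) (\<phi> g)"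
proof -
  have "(\<lambda>(f, g). Fract (\<phi> f) (\<phi> g)) ` hom_frac R A f g = {Fract (\<phi> f) (\<phi> g)}"
    using assms by (auto simp: hom_frac_eq[OF assms] image_iff)
  then show ?thesis by (simp add: \<psi>_def)
qed

lemma carrier_frac_field:
  "x \<in> carrier K \<longleftrightarrow> (\<exists>f g. (f, g) \<in> frac_pairs R A \<and> x = hom_frac R A f g)"
  by (auto simp: frac_field_def quotient_def hom_frac_def)

lemma hom_frac_closed: "(f, g) \<in> frac_pairs R A \<Longrightarrow> hom_frac R A f g \<in> carrier K"
  using carrier_frac_field by blast

lemma \<psi>_inj: "x \<in> carrier K \<Longrightarrow> y \<in> carrier K \<Longrightarrow> \<psi> x = \<psi> y \<Longrightarrow> x = y"
  unfolding carrier_frac_field by (metis \<psi>_hom_frac hom_frac_cong)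

text \<open>The field operations are unions over all representatives. If the value of the resulting
  pair depends only on the values of the arguments, every choice contributes the same class and the
  union collapses. Multiplication and addition are the two instances.\<close>

lemma UN_hom_frac:
  assumes fg: "(f, g) \<in> frac_pairs R A" "(f', g') \<in> frac_pairs R A"
    and c: "\<And>f g f' g'. (f, g) \<in> frac_pairs R A \<Longrightarrow> (f', g') \<in> frac_pairs R A \<Longrightarrow>
              (p f g f' g', q f g f' g') \<in> frac_pairs R A"
    and h: "\<And>f g f' g'. (f, g) \<in> frac_pairs R A \<Longrightarrow> (f', g') \<in> frac_pairs R A \<Longrightarrow>
              Fract (\<phi> (p f g f' g')) (\<phi> (q f g f' g')) = F (Fract (\<phi> f) (\<phi> g)) (Fract (\<phi> f') (\<phi> g'))"
  shows "(\<Union>(f, g)\<in>hom_frac R A f g. \<Union>(f', g')\<in>hom_frac R A f' g'. hom_frac R A (p f g f' g') (q f g f' g'))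
           = hom_frac R A (p f g f' g') (q f g f' g')"
proof -
  have "hom_frac R A (p a b a' b') (q a b a' b') = hom_frac R A (p f g f' g') (q f g f' g')"
    if "(a, b) \<in> hom_frac R A f g" "(a', b') \<in> hom_frac R A f' g'" for a b a' b'
    using that fg by (intro hom_frac_cong c) (auto simp: hom_frac_eq h)
  moreover have "(f, g) \<in> hom_frac R A f g" "(f', g') \<in> hom_frac R A f' g'"
    using fg by (auto simp: hom_frac_eq)
  ultimately show ?thesis by blast
qed

lemma mult_pairs:
  assumes "(f, g) \<in> frac_pairs R A" "(f', g') \<in> frac_pairs R A"
  shows "(f \<otimes> f', g \<otimes> g') \<in> frac_pairs R A"
    and "Fract (\<phi> (f \<otimes> f')) (\<phi> (g \<otimes> g')) = Fract (\<phi> f) (\<phi> g) * Fract (\<phi> f') (\<phi> g')"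
proof -
  obtain i where i: "f \<in> A i" "g \<in> A i" "\<phi> g \<noteq> 0" using assms(1) by (rule frac_pairsE)
  obtain j where j: "f' \<in> A j" "g' \<in> A j" "\<phi> g' \<noteq> 0" using assms(2) by (rule frac_pairsE)
  show "(f \<otimes> f', g \<otimes> g') \<in> frac_pairs R A"
    using i j by (intro frac_pairsI[of _ "i + j"] mult_closed) (auto simp: mult[OF i(2) j(2)])
  show "Fract (\<phi> (f \<otimes> f')) (\<phi> (g \<otimes> g')) = Fract (\<phi> f) (\<phi> g) * Fract (\<phi> f') (\<phi> g')"
    by (simp add: mult[OF i(1) j(1)] mult[OF i(2) j(2)])
qed

lemma add_pairs:
  assumes "(f, g) \<in> frac_pairs R A" "(f', g') \<in> frac_pairs R A"
  shows "((f \<otimes> g') \<oplus> (f' \<otimes> g), g \<otimes> g') \<in> frac_pairs R A"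
    and "Fract (\<phi> ((f \<otimes> g') \<oplus> (f' \<otimes> g))) (\<phi> (g \<otimes> g')) = Fract (\<phi> f) (\<phi> g) + Fract (\<phi> f') (\<phi> g')"
proof -
  obtain i where i: "f \<in> A i" "g \<in> A i" "\<phi> g \<noteq> 0" using assms(1) by (rule frac_pairsE)
  obtain j where j: "f' \<in> A j" "g' \<in> A j" "\<phi> g' \<noteq> 0" using assms(2) by (rule frac_pairsE)
  have c: "f \<otimes> g' \<in> A (i + j)" "f' \<otimes> g \<in> A (i + j)"
    using mult_closed[OF i(1) j(2)] mult_closed[OF j(1) i(2)] by (auto simp: add.commute)
  show "((f \<otimes> g') \<oplus> (f' \<otimes> g), g \<otimes> g') \<in> frac_pairs R A"
    using i j by (intro frac_pairsI[of _ "i + j"] mult_closed add_closed c) (auto simp: mult[OF i(2) j(2)])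
  show "Fract (\<phi> ((f \<otimes> g') \<oplus> (f' \<otimes> g))) (\<phi> (g \<otimes> g')) = Fract (\<phi> f) (\<phi> g) + Fract (\<phi> f') (\<phi> g')"
    using i j by (simp add: add[OF c] mult[OF i(1) j(2)] mult[OF j(1) i(2)] mult[OF i(2) j(2)])
qed

lemma frac_field_mult:
  assumes "(f, g) \<in> frac_pairs R A" "(f', g') \<in> frac_pairs R A"
  shows "hom_frac R A f g \<otimes>\<^bsub>K\<^esub> hom_frac R A f' g' = hom_frac R A (f \<otimes> f') (g \<otimes> g')"
  unfolding frac_field_def monoid.simps using assms
  by (intro UN_hom_frac[where F = times]) (auto simp: mult_pairs)

lemma frac_field_add:
  assumes "(f, g) \<in> frac_pairs R A" "(f', g') \<in> frac_pairs R A"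
  shows "hom_frac R A f g \<oplus>\<^bsub>K\<^esub> hom_frac R A f' g' =
           hom_frac R A ((f \<otimes> g') \<oplus> (f' \<otimes> g)) (g \<otimes> g')"
  unfolding frac_field_def ring.simps using assms
  by (intro UN_hom_frac[where F = "(+)"]) (auto simp: add_pairs)

lemma one_pair: "(\<one>, \<one>) \<in> frac_pairs R A" and zero_pair: "(\<zero>, \<one>) \<in> frac_pairs R A"
  by (auto intro!: frac_pairsI one_closed zero_closed simp: one)

lemma frac_field_one: "\<one>\<^bsub>K\<^esub> = hom_frac R A \<one> \<one>" and frac_field_zero: "\<zero>\<^bsub>K\<^esub> = hom_frac R A \<zero> \<one>"
  by (simp_all add: frac_field_def)

lemma \<psi>_one: "\<psi> \<one>\<^bsub>K\<^esub> = 1" and \<psi>_zero: "\<psi> \<zero>\<^bsub>K\<^esub> = 0"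
  by (simp_all add: frac_field_one frac_field_zero \<psi>_hom_frac one_pair zero_pair one zero
      flip: One_fract_def Zero_fract_def)

lemma
  assumes "x \<in> carrier K" "y \<in> carrier K"
  shows frac_field_mult_closed: "x \<otimes>\<^bsub>K\<^esub> y \<in> carrier K" and \<psi>_mult: "\<psi> (x \<otimes>\<^bsub>K\<^esub> y) = \<psi> x * \<psi> y"
    and frac_field_add_closed: "x \<oplus>\<^bsub>K\<^esub> y \<in> carrier K" and \<psi>_add: "\<psi> (x \<oplus>\<^bsub>K\<^esub> y) = \<psi> x + \<psi> y"
proof -
  obtain f g where x: "(f, g) \<in> frac_pairs R A" "x = hom_frac R A f g"
    using assms(1) carrier_frac_field by blast
  obtain f' g' where y: "(f', g') \<in> frac_pairs R A" "y = hom_frac R A f' g'"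
    using assms(2) carrier_frac_field by blast
  show "x \<otimes>\<^bsub>K\<^esub> y \<in> carrier K" "\<psi> (x \<otimes>\<^bsub>K\<^esub> y) = \<psi> x * \<psi> y"
    using frac_field_mult[OF x(1) y(1)] mult_pairs[OF x(1) y(1)] x y
    by (simp_all add: \<psi>_hom_frac hom_frac_closed)
  show "x \<oplus>\<^bsub>K\<^esub> y \<in> carrier K" "\<psi> (x \<oplus>\<^bsub>K\<^esub> y) = \<psi> x + \<psi> y"
    using frac_field_add[OF x(1) y(1)] add_pairs[OF x(1) y(1)] x y
    by (simp_all add: \<psi>_hom_frac hom_frac_closed)
qed

lemma one_K_closed: "\<one>\<^bsub>K\<^esub> \<in> carrier K" and zero_K_closed: "\<zero>\<^bsub>K\<^esub> \<in> carrier K"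
  by (simp_all add: frac_field_one frac_field_zero hom_frac_closed one_pair zero_pair)

text \<open>The axioms are pulled back from the field of fractions along the injective map
  \<psi>.\<close>

lemma comm_monoid_frac_field: "comm_monoid K"
  by (rule comm_monoidI; (rule \<psi>_inj)?)
     (simp_all add: \<psi>_mult \<psi>_one frac_field_mult_closed one_K_closed mult_ac)

lemma abelian_monoid_frac_field: "abelian_monoid K"
  by (rule abelian_monoidI; (rule \<psi>_inj)?)
     (simp_all add: \<psi>_add \<psi>_zero frac_field_add_closed zero_K_closed add_ac)

lemma frac_field_inv:
  assumes "x \<in> carrier K" "\<psi> x \<noteq> 0"
  shows "inv\<^bsub>K\<^esub> x \<in> carrier K" and "\<psi> (inv\<^bsub>K\<^esub> x) = inverse (\<psi> x)"
proof -
  interpret comm_monoid K by (rule comm_monoid_frac_field)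
  obtain f g where x: "(f, g) \<in> frac_pairs R A" "x = hom_frac R A f g"
    using assms(1) carrier_frac_field by blast
  obtain i where i: "f \<in> A i" "g \<in> A i" "\<phi> g \<noteq> 0" using x(1) by (rule frac_pairsE)
  have "\<phi> f \<noteq> 0" using assms(2) x by (auto simp: \<psi>_hom_frac rat_number_collapse fract_collapse)
  then have y: "(g, f) \<in> frac_pairs R A" using i by (intro frac_pairsI)
  \<comment> \<open>The inverse is a definite description; it is identified by exhibiting the
    swapped fraction.\<close>
  let ?y = "hom_frac R A g f"
  have yK: "?y \<in> carrier K" and "\<psi> ?y = inverse (\<psi> x)"
    using y x by (auto simp: \<psi>_hom_frac hom_frac_closed)
  then have "\<psi> (x \<otimes>\<^bsub>K\<^esub> ?y) = \<psi> \<one>\<^bsub>K\<^esub>" using assms by (simp add: \<psi>_mult \<psi>_one)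
  then have "x \<otimes>\<^bsub>K\<^esub> ?y = \<one>\<^bsub>K\<^esub>" using assms(1) yK by (intro \<psi>_inj) auto
  then have "inv\<^bsub>K\<^esub> x = ?y" using comm_inv_char[OF assms(1) yK] by simp
  then show "inv\<^bsub>K\<^esub> x \<in> carrier K" "\<psi> (inv\<^bsub>K\<^esub> x) = inverse (\<psi> x)"
    using yK \<open>\<psi> ?y = inverse (\<psi> x)\<close> by auto
qed

end

section \<open>The Hibi ideal as a toric ideal\<close>

lemma in_carrier_poly_ring:
  "p \<in> carrier (poly_ring V) \<longleftrightarrow> (\<forall>m\<in>Poly_Mapping.keys p. Poly_Mapping.keys m \<subseteq> V)"
  by (simp add: poly_ring_def)

lemma poly_ring_sel [simp]:
  "x \<otimes>\<^bsub>poly_ring V\<^esub> y = x * y" "x \<oplus>\<^bsub>poly_ring V\<^esub> y = x + y" "\<one>\<^bsub>poly_ring V\<^esub> = 1" "\<zero>\<^bsub>poly_ring V\<^esub> = 0"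
  by (simp_all add: poly_ring_def)

lemma poly_ring_add_closed:
  "p \<in> carrier (poly_ring V) \<Longrightarrow> q \<in> carrier (poly_ring V) \<Longrightarrow> p + q \<in> carrier (poly_ring V)"
  using Poly_Mapping.keys_add[of p q] unfolding in_carrier_poly_ring by blast

lemma poly_ring_mult_closed:
  assumes "p \<in> carrier (poly_ring V)" "q \<in> carrier (poly_ring V)"
  shows "p * q \<in> carrier (poly_ring V)"
  unfolding in_carrier_poly_ring
proof
  fix m assume "m \<in> Poly_Mapping.keys (p * q)"
  then obtain a b where "m = a + b" "a \<in> Poly_Mapping.keys p" "b \<in> Poly_Mapping.keys q"
    using keys_mult[of p q] by blast
  then show "Poly_Mapping.keys m \<subseteq> V" using assms by (auto simp: in_carrier_poly_ring keys_add_mon)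
qed

lemma poly_ring_uminus_closed: "p \<in> carrier (poly_ring V) \<Longrightarrow> - p \<in> carrier (poly_ring V)"
  by (simp add: in_carrier_poly_ring)

lemma poly_ring_zero_closed: "0 \<in> carrier (poly_ring V)" and poly_ring_one_closed: "1 \<in> carrier (poly_ring V)"
  by (simp_all add: in_carrier_poly_ring)

lemma poly_ring_diff_closed:
  "p \<in> carrier (poly_ring V) \<Longrightarrow> q \<in> carrier (poly_ring V) \<Longrightarrow> p - q \<in> carrier (poly_ring V)"
  using poly_ring_add_closed[OF _ poly_ring_uminus_closed, of p V q] by simp

lemma poly_ring_single_closed:
  "Poly_Mapping.keys m \<subseteq> V \<Longrightarrow> Poly_Mapping.single m c \<in> carrier (poly_ring V)"
  by (simp add: in_carrier_poly_ring)

lemma cring_poly_ring: "cring (poly_ring V)"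
proof (rule cringI)
  show "abelian_group (poly_ring V)"
    by (rule abelian_groupI)
       (auto simp: poly_ring_add_closed poly_ring_zero_closed add_ac
             intro!: bexI[OF _ poly_ring_uminus_closed])
  show "comm_monoid (poly_ring V)"
    by (rule comm_monoidI) (auto simp: poly_ring_mult_closed poly_ring_one_closed mult_ac)
qed (simp add: distrib_right)

lemma single_one_eq_iff:
  "Poly_Mapping.single a (1 :: 'b::zero_neq_one) = Poly_Mapping.single b 1 \<longleftrightarrow> a = b"
  by (metis keys_single singleton_inject zero_neq_one)

lemma single_one_nonzero [simp]: "Poly_Mapping.single a (1 :: 'b::zero_neq_one) \<noteq> 0"
  by (metis keys_single keys_zero insert_not_empty zero_neq_one)

section \<open>The toric map and its kernel\<close>

context grassmannian_chain
begin

definition toric_exp :: "nat list \<Rightarrow> nat mon" where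
  "toric_exp l = (\<Sum>i\<in>insert 0 {i \<in> {1..N}. root_enum i \<in> S l}. Poly_Mapping.single i 1)"

lemma lookup_toric_exp:
  "Poly_Mapping.lookup (toric_exp l) i = of_bool (i = 0 \<or> i \<in> {1..N} \<and> root_enum i \<in> S l)"
proof -
  let ?A = "insert 0 {i \<in> {1..N}. root_enum i \<in> S l}"
  have "Poly_Mapping.lookup (toric_exp l) i = (\<Sum>k\<in>?A. if k = i then 1 else 0)"
    by (simp only: toric_exp_def lookup_sum lookup_single when_def)
  also have "\<dots> = of_bool (i \<in> ?A)" by (subst sum.delta) auto
  finally show ?thesis by simp
qed

lemma toric_exp_eq_imp_spec_roots_eq:
  assumes "toric_exp l = toric_exp l'"
  shows "S l = S l'"
proof -
  have "r \<in> S l \<longleftrightarrow> r \<in> S l'" if "r \<in> \<Phi>" for r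
  proof -
    have "r \<in> root_enum ` {1..N}"
      using that bij_betw_imp_surj_on[OF bij_betw_root_enum] by blast
    then obtain i where i: "i \<in> {1..N}" "r = root_enum i" by blast
    have "Poly_Mapping.lookup (toric_exp l'') i = 1 \<longleftrightarrow> r \<in> S l''" for l''
      using i by (simp add: lookup_toric_exp)
    from this[of l] this[of l'] show ?thesis using assms by simp
  qed
  moreover have "S l \<subseteq> \<Phi>" "S l' \<subseteq> \<Phi>" by (auto simp: spec_roots_def)
  ultimately show ?thesis by blast
qed

text \<open>The indicators of an intersection and a union add up to those of the two sets. Hence the
  Hibi relations vanish under the toric map.\<close>

lemma toric_exp_meet_join:
  assumes "l \<in> L" "l' \<in> L"
  shows "toric_exp (lat_meet l l') + toric_exp (lat_join l l') = toric_exp l + toric_exp l'"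
  by (rule poly_mapping_eqI)
     (auto simp: lookup_add lookup_toric_exp spec_roots_meet[OF assms] spec_roots_join[OF assms])

abbreviation "P \<equiv> poly_ring L"
abbreviation "I \<equiv> hibi_ideal d n"
abbreviation "subst_E \<equiv> mon_subst toric_exp"

definition toric :: "nat list cpoly \<Rightarrow> nat cpoly" where
  "toric p = push_mapping subst_E p"

lemma toric_simps [simp]:
  "toric (p + q) = toric p + toric q" "toric (p - q) = toric p - toric q"
  "toric (p * q) = toric p * toric q" "toric 0 = 0" "toric 1 = 1"
  "toric (Poly_Mapping.single m c) = Poly_Mapping.single (subst_E m) c"
  by (simp_all add: toric_def push_mapping_add push_mapping_minus push_mapping_mult mon_subst_add
      flip: single_one)

lemma hibi_relations_closed: "hibi_relations d n \<subseteq> carrier P"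
  by (auto simp: hibi_relations_def pvar_def lat_meet_closed lat_join_closed
      intro!: poly_ring_diff_closed poly_ring_mult_closed poly_ring_single_closed)

lemma ideal_hibi: "ideal I P"
  unfolding hibi_ideal_def
  by (rule ring.genideal_ideal[OF cring.axioms(1)[OF cring_poly_ring] hibi_relations_closed])

lemma hibi_ideal_add: "p \<in> I \<Longrightarrow> q \<in> I \<Longrightarrow> p + q \<in> I"
  using additive_subgroup.a_closed[OF ideal.axioms(1)[OF ideal_hibi]] by simp

lemma hibi_ideal_zero: "0 \<in> I"
  using additive_subgroup.zero_closed[OF ideal.axioms(1)[OF ideal_hibi]] by simp

lemma hibi_ideal_mult: "p \<in> I \<Longrightarrow> q \<in> carrier P \<Longrightarrow> q * p \<in> I"
  using ideal.I_l_closed[OF ideal_hibi] by simp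

lemma hibi_ideal_uminus: "p \<in> I \<Longrightarrow> - p \<in> I"
  using hibi_ideal_mult[of p "-1"] poly_ring_uminus_closed[OF poly_ring_one_closed, where V = L] by simp

lemma hibi_ideal_sum: "(\<And>a. a \<in> A \<Longrightarrow> f a \<in> I) \<Longrightarrow> (\<Sum>a\<in>A. f a) \<in> I"
  by (induction A rule: infinite_finite_induct) (auto simp: hibi_ideal_zero hibi_ideal_add)

lemma hibi_ideal_subset: "I \<subseteq> carrier P"
  using additive_subgroup.a_subset[OF ideal.axioms(1)[OF ideal_hibi]] .

lemma toric_ideal: 
  assumes "p \<in> I" 
  shows "toric p = 0"
proof -
  have hom: "toric \<in> ring_hom P (poly_ring UNIV)"
    by (rule ring_hom_memI) (auto simp: in_carrier_poly_ring)
  have "ring_hom_ring P (poly_ring UNIV) toric"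
    by (rule ring_hom_ringI2) (auto intro: cring.axioms(1) cring_poly_ring hom)
  then have "ideal (a_kernel P (poly_ring UNIV) toric) P"
    by (rule ring_hom_ring.kernel_is_ideal)
  moreover have "hibi_relations d n \<subseteq> a_kernel P (poly_ring UNIV) toric"
    using hibi_relations_closed
    by (auto simp: a_kernel_def' hibi_relations_def pvar_def mult_single toric_exp_meet_join mon_subst_add)
  ultimately have "I \<subseteq> a_kernel P (poly_ring UNIV) toric"
    unfolding hibi_ideal_def by (rule ring.genideal_minimal[OF cring.axioms(1)[OF cring_poly_ring]])
  then show ?thesis using assms by (auto simp: a_kernel_def')
qed

text \<open>Congruence of monomials modulo the ideal. It reduces membership in the ideal to a
  question about exponents.\<close>

definition mon_equiv :: "nat list mon \<Rightarrow> nat list mon \<Rightarrow> bool" where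
  "mon_equiv a b \<longleftrightarrow> Poly_Mapping.single a 1 - Poly_Mapping.single b 1 \<in> I"

lemma mon_equiv_refl: "mon_equiv a a"
  by (simp add: mon_equiv_def hibi_ideal_zero)

lemma mon_equiv_sym: "mon_equiv a b \<Longrightarrow> mon_equiv b a"
  unfolding mon_equiv_def by (drule hibi_ideal_uminus) simp

lemma mon_equiv_trans: "mon_equiv a b \<Longrightarrow> mon_equiv b c \<Longrightarrow> mon_equiv a c"
  unfolding mon_equiv_def by (drule (1) hibi_ideal_add) simp

lemma mon_equiv_add:
  assumes "mon_equiv a b" "Poly_Mapping.keys c \<subseteq> L"
  shows "mon_equiv (c + a) (c + b)"
  using hibi_ideal_mult[of "Poly_Mapping.single a 1 - Poly_Mapping.single b 1" "Poly_Mapping.single c 1"] assms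
  by (simp add: mon_equiv_def right_diff_distrib mult_single poly_ring_single_closed)

lemma mon_equiv_subst: "mon_equiv a b \<Longrightarrow> subst_E a = subst_E b"
  unfolding mon_equiv_def by (drule toric_ideal) (simp add: single_one_eq_iff)

text \<open>This makes the relation uniform: for comparable elements, to which no relation is
  attached, join and meet are the two elements themselves.\<close>

lemma mon_equiv_meet_join:
  assumes "l \<in> L" "l' \<in> L"
  shows "mon_equiv (Poly_Mapping.single l 1 + Poly_Mapping.single l' 1)
           (Poly_Mapping.single (lat_join l l') 1 + Poly_Mapping.single (lat_meet l l') 1)"
proof -
  have inj: "a = b" if "a \<in> L" "b \<in> L" "S a = S b" for a b
    using inj_onD[OF inj_on_spec_roots that(3) that(1) that(2)] .
  consider "S l \<subseteq> S l'" | "S l' \<subseteq> S l" | "\<not> lat_le l l'" "\<not> lat_le l' l"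
    using assms by (auto simp: lat_le_iff_spec_roots)
  then show ?thesis
  proof cases
    case 1
    then have "lat_meet l l' = l" "lat_join l l' = l'"
      using assms by (auto intro!: inj simp: lat_meet_closed lat_join_closed spec_roots_meet spec_roots_join)
    then show ?thesis by (simp add: add.commute mon_equiv_refl)
  next
    case 2
    then have "lat_meet l l' = l'" "lat_join l l' = l"
      using assms by (auto intro!: inj simp: lat_meet_closed lat_join_closed spec_roots_meet spec_roots_join)
    then show ?thesis by (simp add: mon_equiv_refl)
  next
    case 3
    then have "pvar l * pvar l' - pvar (lat_meet l l') * pvar (lat_join l l') \<in> hibi_relations d n"
      using assms by (auto simp: hibi_relations_def)
    then have "pvar l * pvar l' - pvar (lat_meet l l') * pvar (lat_join l l') \<in> I"
      using ring.genideal_self[OF cring.axioms(1)[OF cring_poly_ring] hibi_relations_closed]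
      unfolding hibi_ideal_def by blast
    then show ?thesis by (simp add: mon_equiv_def pvar_def mult_single add.commute)
  qed
qed

text \<open>
  Modulo the relations, the join of all variables of a monomial can be split off.  As the join
  is determined by the toric exponent, monomials of equal exponent are equivalent by induction on
  the degree, without any straightening order.
\<close>
lemma split_off_join:
  assumes "Poly_Mapping.keys a \<subseteq> L" "a \<noteq> 0"
  shows "\<exists>j\<in>L. \<exists>b. Poly_Mapping.keys b \<subseteq> L \<and> mon_equiv a (Poly_Mapping.single j 1 + b) \<and>
           (\<forall>l\<in>Poly_Mapping.keys a. S l \<subseteq> S j)"
  using assms
proof (induction a rule: mon_induct)
  case (add v m)
  show ?case
  proof (cases "m = 0")
    case True
    then show ?thesis using add(1) by (intro bexI[of _ v] exI[of _ 0]) (auto simp: mon_equiv_refl)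
  next
    case False
    then obtain j b where j: "j \<in> L" and b: "Poly_Mapping.keys b \<subseteq> L"
      and eq: "mon_equiv m (Poly_Mapping.single j 1 + b)" and le: "\<forall>l\<in>Poly_Mapping.keys m. S l \<subseteq> S j"
      using add.IH by blast
    \<comment> \<open>The new variable v is merged with the join j found so far; their meet goes
      into the remainder.\<close>
    have "mon_equiv (Poly_Mapping.single v 1 + m) (Poly_Mapping.single v 1 + (Poly_Mapping.single j 1 + b))"
      using eq add(1) by (intro mon_equiv_add) auto
    moreover have "mon_equiv (b + (Poly_Mapping.single v 1 + Poly_Mapping.single j 1))
        (b + (Poly_Mapping.single (lat_join v j) 1 + Poly_Mapping.single (lat_meet v j) 1))"
      by (intro mon_equiv_add mon_equiv_meet_join add(1) j b)
    ultimately have "mon_equiv (Poly_Mapping.single v 1 + m)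
        (Poly_Mapping.single (lat_join v j) 1 + (Poly_Mapping.single (lat_meet v j) 1 + b))"
      using mon_equiv_trans by (simp add: ac_simps)
    moreover have "\<forall>l\<in>Poly_Mapping.keys (Poly_Mapping.single v 1 + m). S l \<subseteq> S (lat_join v j)"
      using le by (auto simp: keys_add_mon spec_roots_join[OF add(1) j])
    ultimately show ?thesis
      using lat_join_closed[OF add(1) j] lat_meet_closed[OF add(1) j] b
      by (intro bexI[of _ "lat_join v j"] exI[of _ "Poly_Mapping.single (lat_meet v j) 1 + b"])
         (auto simp: keys_add_mon)
  qed
qed simp

lemma lookup_subst_E_zero: "Poly_Mapping.lookup (subst_E a) 0 = mon_degree a"
  by (rule mon_degree_eq_lookup[symmetric]) (simp add: lookup_toric_exp)

text \<open>The exponent of the join is the indicator of the support of the exponent of a. It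
  contains that support because every ideal in a lies in that of j, and it is contained in it
  because \<open>toric_exp j\<close> is a summand of \<open>subst_E a\<close>.\<close>

lemma join_roots:
  assumes "Poly_Mapping.keys a \<subseteq> L" "j \<in> L"
    and "mon_equiv a (Poly_Mapping.single j 1 + b)" "\<forall>l\<in>Poly_Mapping.keys a. S l \<subseteq> S j"
  shows "toric_exp j = (\<Sum>i\<in>Poly_Mapping.keys (subst_E a). Poly_Mapping.single i 1)" (is "_ = ?R")
proof (rule poly_mapping_eqI)
  fix i
  have eq: "subst_E a = toric_exp j + subst_E b"
    using mon_equiv_subst[OF assms(3)] by (simp add: mon_subst_add)
  have "Poly_Mapping.lookup (subst_E a) i \<noteq> 0 \<longleftrightarrow> Poly_Mapping.lookup (toric_exp j) i \<noteq> 0"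
  proof
    assume "Poly_Mapping.lookup (subst_E a) i \<noteq> 0"
    then obtain l where "l \<in> Poly_Mapping.keys a" "Poly_Mapping.lookup (toric_exp l) i \<noteq> 0"
      by (auto simp: lookup_mon_subst)
    then show "Poly_Mapping.lookup (toric_exp j) i \<noteq> 0" using assms(4) by (auto simp: lookup_toric_exp)
  qed (simp add: eq lookup_add)
  moreover have "Poly_Mapping.lookup ?R i = of_bool (i \<in> Poly_Mapping.keys (subst_E a))"
    by (simp add: lookup_sum lookup_single when_def)
  ultimately show "Poly_Mapping.lookup (toric_exp j) i = Poly_Mapping.lookup ?R i"
    by (auto simp: in_keys_iff lookup_toric_exp split: if_splits)
qed

text \<open>Equal exponents have equal supports, so the same join splits off from both monomials.
  Cancelling it leaves equal exponents in smaller degree.\<close>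

lemma mon_equivI:
  assumes "Poly_Mapping.keys a \<subseteq> L" "Poly_Mapping.keys b \<subseteq> L" "subst_E a = subst_E b"
  shows "mon_equiv a b"
  using assms
proof (induction "mon_degree a" arbitrary: a b)
  case 0
  then have "a = 0" "b = 0"
    by (metis lookup_subst_E_zero mon_degree_eq_0_iff)+
  then show ?case by (simp add: mon_equiv_refl)
next
  case (Suc k)
  have deg: "mon_degree b = mon_degree a" using Suc.prems(3) by (metis lookup_subst_E_zero)
  have "a \<noteq> 0" "b \<noteq> 0" using deg Suc.hyps(2) by auto
  then obtain j a' j' b' where a': "j \<in> L" "Poly_Mapping.keys a' \<subseteq> L"
      "mon_equiv a (Poly_Mapping.single j 1 + a')" "\<forall>l\<in>Poly_Mapping.keys a. S l \<subseteq> S j"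
    and b': "j' \<in> L" "Poly_Mapping.keys b' \<subseteq> L"
      "mon_equiv b (Poly_Mapping.single j' 1 + b')" "\<forall>l\<in>Poly_Mapping.keys b. S l \<subseteq> S j'"
    using split_off_join[OF Suc.prems(1)] split_off_join[OF Suc.prems(2)] by meson
  have "toric_exp j = toric_exp j'"
    using join_roots[OF Suc.prems(1) a'(1,3,4)] join_roots[OF Suc.prems(2) b'(1,3,4)] Suc.prems(3) by simp
  then have jj: "j = j'"
    using inj_onD[OF inj_on_spec_roots toric_exp_eq_imp_spec_roots_eq] a'(1) b'(1) by blast
  have "toric_exp j + subst_E a' = toric_exp j + subst_E b'"
    using mon_equiv_subst[OF a'(3)] mon_equiv_subst[OF b'(3)] Suc.prems(3) jj by (simp add: mon_subst_add)
  then have "subst_E a' = subst_E b'" by simp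
  moreover have "mon_degree a = 1 + mon_degree a'"
    using mon_equiv_subst[OF a'(3)]
    by (metis lookup_subst_E_zero mon_degree_add mon_degree_single)
  ultimately have "mon_equiv a' b'" using Suc.hyps a'(2) b'(2) by simp
  then have "mon_equiv (Poly_Mapping.single j 1 + a') (Poly_Mapping.single j 1 + b')"
    using a'(1) by (intro mon_equiv_add) auto
  then show ?case using a'(3) b'(3) jj mon_equiv_trans mon_equiv_sym by blast
qed

text \<open>Choose one monomial \<open>s e\<close> for every toric exponent e. Modulo the ideal,
  each monomial of a kernel element p may be replaced by its chosen one. The result is the
  push-forward of \<open>toric p\<close> along s, which is 0, so p is a combination of differences
  of equivalent monomials.\<close>

lemma hibi_ideal_eq_kernel: "I = {p \<in> carrier P. toric p = 0}"
proof (intro equalityI subsetI)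
  fix p assume "p \<in> {p \<in> carrier P. toric p = 0}"
  then have p: "p \<in> carrier P" "toric p = 0" by auto
  define s where "s e = (SOME m. Poly_Mapping.keys m \<subseteq> L \<and> subst_E m = e)" for e
  have s: "Poly_Mapping.keys (s (subst_E m)) \<subseteq> L" "subst_E (s (subst_E m)) = subst_E m"
    if "Poly_Mapping.keys m \<subseteq> L" for m
    unfolding s_def by (rule someI2[where a = m]; use that in simp)+
  have eq: "mon_equiv m (s (subst_E m))" if "m \<in> Poly_Mapping.keys p" for m
    using that p(1) s by (intro mon_equivI) (auto simp: in_carrier_poly_ring)
  have "(\<Sum>m\<in>Poly_Mapping.keys p. Poly_Mapping.single (s (subst_E m)) (Poly_Mapping.lookup p m))
      = push_mapping s (toric p)"
    unfolding toric_def push_mapping_comp by (simp add: push_mapping_def)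
  then have "(\<Sum>m\<in>Poly_Mapping.keys p. Poly_Mapping.single (s (subst_E m)) (Poly_Mapping.lookup p m)) = 0"
    using p(2) by simp
  then have "p = (\<Sum>m\<in>Poly_Mapping.keys p. Poly_Mapping.single m (Poly_Mapping.lookup p m) -
                     Poly_Mapping.single (s (subst_E m)) (Poly_Mapping.lookup p m))"
    unfolding sum_subtractf by (simp flip: poly_mapping_sum_single)
  also have "\<dots> = (\<Sum>m\<in>Poly_Mapping.keys p. Poly_Mapping.single 0 (Poly_Mapping.lookup p m) *
                     (Poly_Mapping.single m 1 - Poly_Mapping.single (s (subst_E m)) 1))"
    by (simp add: right_diff_distrib mult_single)
  also have "\<dots> \<in> I"
    using eq by (intro hibi_ideal_sum hibi_ideal_mult) (auto simp: mon_equiv_def poly_ring_single_closed)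
  finally show "p \<in> I" .
qed (use hibi_ideal_subset toric_ideal in auto)

section \<open>The graded Hibi ring inside the polynomial ring\<close>

lemma hibi_class_eq:
  assumes "p \<in> carrier P"
  shows "hibi_class d n p = {q \<in> carrier P. toric q = toric p}"
proof -
  have "q \<in> hibi_class d n p \<longleftrightarrow> q \<in> carrier P \<and> toric q = toric p" for q
  proof
    assume "q \<in> hibi_class d n p"
    then obtain h where "h \<in> I" "q = h + p"
      by (auto simp: hibi_class_def a_r_coset_def')
    then show "q \<in> carrier P \<and> toric q = toric p"
      using assms by (auto simp: hibi_ideal_eq_kernel poly_ring_add_closed)
  next
    assume "q \<in> carrier P \<and> toric q = toric p"
    then have "q - p \<in> I" using assms by (simp add: hibi_ideal_eq_kernel poly_ring_diff_closed)
    then show "q \<in> hibi_class d n p"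
      by (auto simp: hibi_class_def a_r_coset_def' intro!: bexI[of _ "q - p"])
  qed
  then show ?thesis by auto
qed

text \<open>A residue class is a fibre of \<open>toric\<close> by \<open>hibi_class_eq\<close>, so
  its image is a singleton.\<close>

definition toric_class :: "nat list cpoly set \<Rightarrow> nat cpoly" where
  "toric_class X = the_elem (toric ` X)"

lemma toric_class [simp]:
  assumes "p \<in> carrier P"
  shows "toric_class (hibi_class d n p) = toric p"
proof -
  have "toric ` hibi_class d n p = {toric p}" using assms by (auto simp: hibi_class_eq)
  then show ?thesis by (simp add: toric_class_def)
qed

lemma hibi_class_cong: "p \<in> carrier P \<Longrightarrow> q \<in> carrier P \<Longrightarrow> toric p = toric q \<Longrightarrow> hibi_class d n p = hibi_class d n q"
  by (simp add: hibi_class_eq)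

lemma hibi_class_hom: "hibi_class d n \<in> ring_hom P (hibi_ring d n)"
proof -
  have "hibi_class d n = (+>\<^bsub>P\<^esub>) I" by (rule ext) (simp add: hibi_class_def)
  then show ?thesis using ideal.rcos_ring_hom[OF ideal_hibi] by (simp add: hibi_ring_def)
qed

lemma
  assumes "p \<in> carrier P" "q \<in> carrier P"
  shows hibi_class_mult: "hibi_class d n p \<otimes>\<^bsub>hibi_ring d n\<^esub> hibi_class d n q = hibi_class d n (p * q)"
    and hibi_class_add: "hibi_class d n p \<oplus>\<^bsub>hibi_ring d n\<^esub> hibi_class d n q = hibi_class d n (p + q)"
  using ring_hom_mult[OF hibi_class_hom assms] ring_hom_add[OF hibi_class_hom assms] by simp_all

lemma hibi_class_one: "\<one>\<^bsub>hibi_ring d n\<^esub> = hibi_class d n 1"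
  using ring_hom_one[OF hibi_class_hom] by simp

lemma hibi_class_zero: "\<zero>\<^bsub>hibi_ring d n\<^esub> = hibi_class d n 0"
  by (simp add: hibi_class_eq poly_ring_zero_closed hibi_ring_def FactRing_def hibi_ideal_eq_kernel)

lemma homogeneous_closed: "p \<in> homogeneous_polys L i \<Longrightarrow> p \<in> carrier P"
  by (simp add: homogeneous_polys_def)

lemma homogeneous_mult:
  assumes "p \<in> homogeneous_polys L i" "q \<in> homogeneous_polys L j"
  shows "p * q \<in> homogeneous_polys L (i + j)"
proof -
  have "mon_degree m = i + j" if "m \<in> Poly_Mapping.keys (p * q)" for m
    using that keys_mult[of p q] assms by (auto simp: homogeneous_polys_def mon_degree_add)
  then show ?thesis using assms by (simp add: homogeneous_polys_def poly_ring_mult_closed)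
qed

lemma homogeneous_add:
  assumes "p \<in> homogeneous_polys L i" "q \<in> homogeneous_polys L i"
  shows "p + q \<in> homogeneous_polys L i"
proof -
  have "mon_degree m = i" if "m \<in> Poly_Mapping.keys (p + q)" for m
    using that Poly_Mapping.keys_add[of p q] assms by (auto simp: homogeneous_polys_def)
  then show ?thesis using assms by (simp add: homogeneous_polys_def poly_ring_add_closed)
qed

lemma homogeneous_single:
  "Poly_Mapping.keys m \<subseteq> L \<Longrightarrow> mon_degree m = i \<Longrightarrow> Poly_Mapping.single m c \<in> homogeneous_polys L i"
  by (auto simp: homogeneous_polys_def poly_ring_single_closed)

lemma homogeneous_zero: "0 \<in> homogeneous_polys L i"
  by (simp add: homogeneous_polys_def poly_ring_zero_closed)

lemma hibi_componentE:
  assumes "x \<in> hibi_component d n i"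
  obtains p where "p \<in> homogeneous_polys L i" "p \<in> carrier P" "x = hibi_class d n p"
  using assms homogeneous_closed by (auto simp: hibi_component_def)

lemma hibi_componentI: "p \<in> homogeneous_polys L i \<Longrightarrow> hibi_class d n p \<in> hibi_component d n i"
  by (simp add: hibi_component_def)

sublocale hibi: graded_embedding "hibi_ring d n" "hibi_component d n" toric_class
proof
  fix f g i assume "f \<in> hibi_component d n i" "g \<in> hibi_component d n i" "toric_class f = toric_class g"
  then show "f = g"
    by (elim hibi_componentE) (metis hibi_class_cong toric_class)
next
  fix f g i j assume "f \<in> hibi_component d n i" "g \<in> hibi_component d n j"
  then show "f \<otimes>\<^bsub>hibi_ring d n\<^esub> g \<in> hibi_component d n (i + j)"
    and "toric_class (f \<otimes>\<^bsub>hibi_ring d n\<^esub> g) = toric_class f * toric_class g"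
    by (auto elim!: hibi_componentE intro!: hibi_componentI homogeneous_mult
        simp: hibi_class_mult poly_ring_mult_closed)
next
  fix f g i assume "f \<in> hibi_component d n i" "g \<in> hibi_component d n i"
  then show "f \<oplus>\<^bsub>hibi_ring d n\<^esub> g \<in> hibi_component d n i"
    and "toric_class (f \<oplus>\<^bsub>hibi_ring d n\<^esub> g) = toric_class f + toric_class g"
    by (auto elim!: hibi_componentE intro!: hibi_componentI homogeneous_add
        simp: hibi_class_add poly_ring_add_closed)
next
  have "1 \<in> homogeneous_polys L 0"
    using homogeneous_single[of 0 0 1] by simp
  then show "\<one>\<^bsub>hibi_ring d n\<^esub> \<in> hibi_component d n 0"
    by (simp add: hibi_class_one hibi_componentI)
  show "toric_class \<one>\<^bsub>hibi_ring d n\<^esub> = 1" "toric_class \<zero>\<^bsub>hibi_ring d n\<^esub> = 0"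
    by (simp_all add: hibi_class_one hibi_class_zero poly_ring_one_closed poly_ring_zero_closed)
  fix i show "\<zero>\<^bsub>hibi_ring d n\<^esub> \<in> hibi_component d n i"
    by (simp add: hibi_class_zero hibi_componentI homogeneous_zero)
qed

end

section \<open>The valuation\<close>

lemma revlex_less_irrefl: "\<not> revlex_less a a"
  by (simp add: revlex_less_def)

lemma revlex_less_trans:
  assumes "revlex_less a b" "revlex_less b c"
  shows "revlex_less a c"
proof -
  obtain k where k: "a k < b k" "\<forall>i>k. a i = b i" using assms(1) by (auto simp: revlex_less_def)
  obtain l where l: "b l < c l" "\<forall>i>l. b i = c i" using assms(2) by (auto simp: revlex_less_def)
  show ?thesis unfolding revlex_less_def
    using k l by (intro exI[of _ "max k l"]) (cases k l rule: linorder_cases; auto simp: max_def)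
qed

lemma revlex_less_add_right: "revlex_less a b \<Longrightarrow> revlex_less (a + c) (b + c)"
  by (simp add: revlex_less_def)

lemma revlex_less_add_mono:
  assumes "revlex_less a b" "revlex_less c e"
  shows "revlex_less (a + c) (b + e)"
proof (rule revlex_less_trans)
  show "revlex_less (a + c) (b + c)" using assms(1) by (rule revlex_less_add_right)
  show "revlex_less (b + c) (b + e)"
    using revlex_less_add_right[OF assms(2), of b] by (simp add: add.commute)
qed

section \<open>Least exponents of polynomials\<close>

definition int_exponent :: "nat mon \<Rightarrow> nat \<Rightarrow> int" where
  "int_exponent m = (\<lambda>i. int (Poly_Mapping.lookup m i))"

lemma int_exponent_add: "int_exponent (a + b) = int_exponent a + int_exponent b"
  by (auto simp: int_exponent_def lookup_add)

lemma int_exponent_inject: "int_exponent a = int_exponent b \<longleftrightarrow> a = b"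
  by (auto simp: int_exponent_def fun_eq_iff intro: poly_mapping_eqI)

text \<open>Totality rests on finite supports: two exponents differ in finitely many coordinates,
  and the last of these decides.\<close>

lemma revlex_less_int_exponent_total:
  assumes "a \<noteq> b"
  shows "revlex_less (int_exponent a) (int_exponent b) \<or> revlex_less (int_exponent b) (int_exponent a)"
proof -
  let ?D = "{i. Poly_Mapping.lookup a i \<noteq> Poly_Mapping.lookup b i}"
  have fin: "finite ?D"
    by (rule finite_subset[of _ "Poly_Mapping.keys a \<union> Poly_Mapping.keys b"]) (auto simp: in_keys_iff)
  have ne: "?D \<noteq> {}" using assms by (auto intro: poly_mapping_eqI)
  obtain k where k: "k \<in> ?D" "\<And>i. k < i \<Longrightarrow> i \<notin> ?D"
    using Max_in[OF fin ne] Max_ge[OF fin] leD by blast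
  have eq: "int_exponent a i = int_exponent b i" if "k < i" for i
    using k(2)[OF that] by (simp add: int_exponent_def)
  have "int_exponent a k < int_exponent b k \<or> int_exponent b k < int_exponent a k"
    using k(1) by (auto simp: int_exponent_def)
  then show ?thesis unfolding revlex_less_def using eq by metis
qed

definition is_initial :: "nat cpoly \<Rightarrow> nat mon \<Rightarrow> bool" where
  "is_initial p a \<longleftrightarrow> a \<in> Poly_Mapping.keys p \<and>
     (\<forall>b\<in>Poly_Mapping.keys p. b \<noteq> a \<longrightarrow> revlex_less (int_exponent a) (int_exponent b))"

lemma is_initial_unique: "is_initial p a \<Longrightarrow> is_initial p b \<Longrightarrow> a = b"
  unfolding is_initial_def
  using revlex_less_trans[of "int_exponent a" "int_exponent b" "int_exponent a"] revlex_less_irrefl[of "int_exponent a"] by metis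

lemma is_initial_single: "is_initial (Poly_Mapping.single m 1) m"
  by (simp add: is_initial_def)

lemma is_initial_exists:
  assumes "p \<noteq> 0"
  obtains a where "is_initial p a"
proof -
  have "\<exists>a\<in>A. \<forall>b\<in>A. b \<noteq> a \<longrightarrow> revlex_less (int_exponent a) (int_exponent b)" if "finite A" "A \<noteq> {}" for A
    using that
  proof (induction A rule: finite_ne_induct)
    case (insert x F)
    then obtain a where a: "a \<in> F" "\<forall>b\<in>F. b \<noteq> a \<longrightarrow> revlex_less (int_exponent a) (int_exponent b)" by blast
    show ?case
    proof (cases "revlex_less (int_exponent x) (int_exponent a)")
      case True
      then show ?thesis using a revlex_less_trans by (intro bexI[of _ x]) auto
    next
      case False
      then show ?thesis using a insert.hyps revlex_less_int_exponent_total[of x a]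
        by (intro bexI[of _ a]) auto
    qed
  qed auto
  from this[of "Poly_Mapping.keys p"] show thesis using that assms by (auto simp: is_initial_def)
qed

text \<open>Every other pair of exponents has a strictly larger sum, so a + b arises only once and
  its coefficient is a product of two nonzero complex numbers.\<close>

lemma is_initial_mult:
  assumes p: "is_initial p a" and q: "is_initial q b"
  shows "is_initial (p * q) (a + b)"
proof -
  have less: "revlex_less (int_exponent (a + b)) (int_exponent (a' + b'))"
    if "a' \<in> Poly_Mapping.keys p" "b' \<in> Poly_Mapping.keys q" "a' \<noteq> a \<or> b' \<noteq> b" for a' b'
  proof (cases "a' = a")
    case True
    then show ?thesis using that q revlex_less_add_right[of "int_exponent b" "int_exponent b'" "int_exponent a"]
      by (auto simp: is_initial_def int_exponent_add add.commute)
  next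
    case False
    then show ?thesis
      using that p q revlex_less_add_right[of "int_exponent a" "int_exponent a'" "int_exponent b"]
        revlex_less_add_mono[of "int_exponent a" "int_exponent a'" "int_exponent b" "int_exponent b'"]
      by (cases "b' = b") (auto simp: is_initial_def int_exponent_add)
  qed
  have eq: "a' + b' = a + b \<longleftrightarrow> a' = a \<and> b' = b"
    if "a' \<in> Poly_Mapping.keys p" "b' \<in> Poly_Mapping.keys q" for a' b'
    using less[OF that] revlex_less_irrefl[of "int_exponent (a + b)"] by metis
  let ?c = "\<lambda>a' b'. Poly_Mapping.lookup p a' * Poly_Mapping.lookup q b'"
  have "p * q = (\<Sum>a'\<in>Poly_Mapping.keys p. Poly_Mapping.single a' (Poly_Mapping.lookup p a')) *
      (\<Sum>b'\<in>Poly_Mapping.keys q. Poly_Mapping.single b' (Poly_Mapping.lookup q b'))"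
    by (simp flip: poly_mapping_sum_single)
  then have "Poly_Mapping.lookup (p * q) (a + b) =
      (\<Sum>a'\<in>Poly_Mapping.keys p. \<Sum>b'\<in>Poly_Mapping.keys q. if a' + b' = a + b then ?c a' b' else 0)"
    by (simp only: sum_product mult_single lookup_sum lookup_single when_def)
  also have "\<dots> = (\<Sum>a'\<in>Poly_Mapping.keys p. \<Sum>b'\<in>Poly_Mapping.keys q.
      if b' = b then (if a' = a then ?c a' b' else 0) else 0)"
    by (intro sum.cong refl) (simp add: eq)
  also have "\<dots> = ?c a b"
    using p q by (simp add: is_initial_def)
  also have "\<dots> \<noteq> 0" using p q by (simp add: is_initial_def in_keys_iff)
  finally have "a + b \<in> Poly_Mapping.keys (p * q)" by (simp add: in_keys_iff)
  moreover have "revlex_less (int_exponent (a + b)) (int_exponent m)" if "m \<in> Poly_Mapping.keys (p * q)" "m \<noteq> a + b" for m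
    using that keys_mult[of p q] less by force
  ultimately show ?thesis by (simp add: is_initial_def)
qed

section \<open>The generators along the chain and the values of homogeneous elements\<close>

context grassmannian_chain
begin

abbreviation "K \<equiv> hibi_field d n"
abbreviation "\<psi> \<equiv> hibi.\<psi>"
abbreviation "T \<equiv> poly_ring {1..N}"

lemmas K_mult_closed = hibi.frac_field_mult_closed[folded hibi_field_def]
lemmas K_mult = hibi.\<psi>_mult[folded hibi_field_def]
lemmas K_add = hibi.\<psi>_add[folded hibi_field_def]
lemmas K_zero = hibi.\<psi>_zero[folded hibi_field_def]
lemmas K_one = hibi.\<psi>_one[folded hibi_field_def]
lemmas K_inj = hibi.\<psi>_inj[folded hibi_field_def]
lemmas K_inv = hibi.frac_field_inv[folded hibi_field_def]
lemmas K_comm_monoid = hibi.comm_monoid_frac_field[folded hibi_field_def]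
lemmas K_abelian_monoid = hibi.abelian_monoid_frac_field[folded hibi_field_def]

lemma hibi_frac:
  assumes "p \<in> homogeneous_polys L i" "q \<in> homogeneous_polys L i" "toric q \<noteq> 0"
  shows "hibi_frac d n (hibi_class d n p) (hibi_class d n q) \<in> carrier K"
    and "\<psi> (hibi_frac d n (hibi_class d n p) (hibi_class d n q)) = to_fract (toric p) / to_fract (toric q)"
proof -
  have pq: "p \<in> carrier P" "q \<in> carrier P" using assms by (auto simp: homogeneous_closed)
  have "(hibi_class d n p, hibi_class d n q) \<in> frac_pairs (hibi_ring d n) (hibi_component d n)"
    using assms pq by (intro hibi.frac_pairsI[of _ i]) (auto intro: hibi_componentI)
  then show "hibi_frac d n (hibi_class d n p) (hibi_class d n q) \<in> carrier K"
    and "\<psi> (hibi_frac d n (hibi_class d n p) (hibi_class d n q)) = to_fract (toric p) / to_fract (toric q)"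
    using pq assms(3)
    by (simp_all add: hibi_frac_def hibi_field_def hibi.hom_frac_closed hibi.\<psi>_hom_frac Fract_eq_to_fract)
qed

text \<open>The exponent of \<open>x_hat c\<^sub>j\<close>.\<close>
definition chain_exp :: "nat \<Rightarrow> nat mon" where
  "chain_exp j = (\<Sum>i\<in>{1..j}. Poly_Mapping.single i 1)"

abbreviation "W \<equiv> mon_subst chain_exp"

lemma lookup_chain_exp: "Poly_Mapping.lookup (chain_exp j) i = of_bool (i \<in> {1..j})"
  by (simp add: chain_exp_def lookup_sum lookup_single when_def)

lemma toric_exp_bot: "toric_exp (lat_bot d) = Poly_Mapping.single 0 1"
  by (rule poly_mapping_eqI) (simp add: lookup_toric_exp spec_roots_lat_bot lookup_single when_def)

lemma toric_exp_chain_elem: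
  assumes "j \<le> N"
  shows "toric_exp (chain_elem C j) = chain_exp j + Poly_Mapping.single 0 1"
proof (rule poly_mapping_eqI)
  fix i
  have "i \<in> {1..N} \<and> root_enum i \<in> S (chain_elem C j) \<longleftrightarrow> i \<in> {1..j}"
    using assms root_enum_mem_iff[of i j] by auto
  then show "Poly_Mapping.lookup (toric_exp (chain_elem C j)) i
      = Poly_Mapping.lookup (chain_exp j + Poly_Mapping.single 0 1) i"
    by (simp only: lookup_toric_exp lookup_add lookup_chain_exp lookup_single) (auto simp: when_def)
qed

lemma pvar_homogeneous: "l \<in> L \<Longrightarrow> pvar l \<in> homogeneous_polys L 1"
  unfolding pvar_def by (rule homogeneous_single) auto

lemma toric_pvar: "toric (pvar l) = Poly_Mapping.single (toric_exp l) 1"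
  by (simp add: pvar_def)

lemma x_hat_chain_elem:
  assumes "j \<le> N"
  shows "x_hat d n (chain_elem C j) \<in> carrier K"
    and "\<psi> (x_hat d n (chain_elem C j)) = to_fract (Poly_Mapping.single (chain_exp j) 1)"
proof -
  note h = hibi_frac[OF pvar_homogeneous[OF chain_elem_closed[OF assms]]
      pvar_homogeneous[OF lat_bot_closed[OF d_le]], folded x_hat_def]
  show "x_hat d n (chain_elem C j) \<in> carrier K"
    using h(1) by (simp add: toric_pvar)
  have "Poly_Mapping.single (toric_exp (chain_elem C j)) (1::complex)
      = Poly_Mapping.single (chain_exp j) 1 * Poly_Mapping.single (toric_exp (lat_bot d)) 1"
    using toric_exp_chain_elem[OF assms] by (simp add: mult_single toric_exp_bot)
  then show "\<psi> (x_hat d n (chain_elem C j)) = to_fract (Poly_Mapping.single (chain_exp j) 1)"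
    using h(2) by (simp add: toric_pvar)
qed

text \<open>Under \<psi> the evaluation at the generators becomes the substitution of t_1 ... t_j
  for the j-th variable.\<close>

lemma eval_chain:
  assumes "F \<in> carrier T"
  shows "eval_chain d n C F \<in> carrier K"
    and "\<psi> (eval_chain d n C F) = to_fract (push_mapping W F)"
proof -
  interpret comm_monoid K by (rule K_comm_monoid)
  interpret A: abelian_monoid K by (rule K_abelian_monoid)
  have sub: "j \<le> N" if "m \<in> Poly_Mapping.keys F" "j \<in> Poly_Mapping.keys m" for m j
    using assms that by (auto simp: in_carrier_poly_ring subset_iff)
  define c where "c m = hibi_frac d n (hibi_class d n (pconst (Poly_Mapping.lookup F m))) \<one>\<^bsub>hibi_ring d n\<^esub>" for m
  define g where "g m = finprod K (\<lambda>j. x_hat d n (chain_elem C j) [^]\<^bsub>K\<^esub> Poly_Mapping.lookup m j)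
      (Poly_Mapping.keys m)" for m :: "nat mon"
  have hom: "pconst a \<in> homogeneous_polys L 0" "1 \<in> homogeneous_polys L 0" for a
    using homogeneous_single[of 0 0 1] homogeneous_single[of 0 0 a] by (simp_all add: pconst_def)
  have c: "c m \<in> carrier K" "\<psi> (c m) = to_fract (Poly_Mapping.single 0 (Poly_Mapping.lookup F m))" for m
    unfolding c_def hibi_class_one using hibi_frac[OF hom] by (simp_all add: pconst_def)
  have pow: "x_hat d n (chain_elem C j) [^]\<^bsub>K\<^esub> k \<in> carrier K"
      "\<psi> (x_hat d n (chain_elem C j) [^]\<^bsub>K\<^esub> k) = to_fract (Poly_Mapping.single (\<Sum>_<k. chain_exp j) 1)"
    if "j \<le> N" for j and k :: nat
    using x_hat_chain_elem[OF that]
    by (simp_all add: nat_pow_transport[OF K_comm_monoid K_one K_mult] single_one_power flip: to_fract_power)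
  have gK: "g m \<in> carrier K" if "m \<in> Poly_Mapping.keys F" for m
    unfolding g_def using sub[OF that] pow by (intro finprod_closed) auto
  have g: "\<psi> (g m) = to_fract (Poly_Mapping.single (W m) 1)" if "m \<in> Poly_Mapping.keys F" for m
  proof -
    have "\<psi> (g m) = (\<Prod>j\<in>Poly_Mapping.keys m. to_fract (Poly_Mapping.single (\<Sum>_<Poly_Mapping.lookup m j. chain_exp j) 1))"
      unfolding g_def using sub[OF that] pow
      by (subst finprod_transport[OF K_comm_monoid K_one K_mult]) auto
    then show ?thesis by (simp add: mon_subst_def prod_single_one flip: to_fract_prod)
  qed
  have e: "eval_chain d n C F = finsum K (\<lambda>m. c m \<otimes>\<^bsub>K\<^esub> g m) (Poly_Mapping.keys F)"
    by (simp add: eval_chain_def c_def g_def)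
  show "eval_chain d n C F \<in> carrier K"
    unfolding e using c gK by (intro A.finsum_closed) auto
  have "\<psi> (eval_chain d n C F) = (\<Sum>m\<in>Poly_Mapping.keys F. \<psi> (c m \<otimes>\<^bsub>K\<^esub> g m))"
    unfolding e using c gK by (intro finsum_transport[OF K_abelian_monoid K_zero K_add]) auto
  also have "\<dots> = (\<Sum>m\<in>Poly_Mapping.keys F. to_fract (Poly_Mapping.single (W m) (Poly_Mapping.lookup F m)))"
    by (intro sum.cong refl) (simp add: K_mult c gK g mult_single flip: to_fract_simps)
  also have "\<dots> = to_fract (push_mapping W F)"
    by (simp add: push_mapping_def to_fract_sum)
  finally show "\<psi> (eval_chain d n C F) = to_fract (push_mapping W F)" .
qed

text \<open>The v-th generator contains t_i exactly for 1 \<le> i \<le> v. So \<open>W\<close> takes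
  tail sums, a unitriangular change of coordinates.\<close>

lemma lookup_W:
  assumes "Poly_Mapping.keys m \<subseteq> {1..N}"
  shows "Poly_Mapping.lookup (W m) i = (if i = 0 then 0 else (\<Sum>v\<in>{i..N}. Poly_Mapping.lookup m v))"
proof -
  have "Poly_Mapping.lookup (W m) i = (\<Sum>v\<in>{1..N}. if i \<in> {1..v} then Poly_Mapping.lookup m v else 0)"
    by (subst lookup_mon_subst_superset[OF _ assms]) (simp_all add: lookup_chain_exp of_bool_def if_distrib cong: if_cong)
  also have "\<dots> = (\<Sum>v\<in>{v \<in> {1..N}. i \<in> {1..v}}. Poly_Mapping.lookup m v)"
    by (rule sum.inter_filter[symmetric]) simp
  also have "{v \<in> {1..N}. i \<in> {1..v}} = (if i = 0 then {} else {i..N})"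
    by auto
  finally show ?thesis by (simp split: if_splits)
qed

text \<open>Entries are recovered as differences of consecutive tail sums. In terms of exponents
  this is the algebraic independence of the generators.\<close>

lemma inj_on_W: "inj_on W {m. Poly_Mapping.keys m \<subseteq> {1..N}}"
proof (rule inj_onI)
  fix m m' assume m: "m \<in> {m. Poly_Mapping.keys m \<subseteq> {1..N}}" "m' \<in> {m. Poly_Mapping.keys m \<subseteq> {1..N}}"
    and eq: "W m = W m'"
  have rec: "Poly_Mapping.lookup (W r) i = Poly_Mapping.lookup r i + Poly_Mapping.lookup (W r) (Suc i)"
    if "r \<in> {m, m'}" "i \<in> {1..N}" for r i
  proof -
    have "{i..N} = insert i {Suc i..N}" using that(2) by auto
    then show ?thesis using that m by (auto simp: lookup_W)
  qed
  show "m = m'"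
  proof (rule poly_mapping_eqI)
    fix i show "Poly_Mapping.lookup m i = Poly_Mapping.lookup m' i"
    proof (cases "i \<in> {1..N}")
      case True
      then show ?thesis using rec[of m i] rec[of m' i] eq by simp
    next
      case False
      then have "i \<notin> Poly_Mapping.keys m" "i \<notin> Poly_Mapping.keys m'" using m by auto
      then show ?thesis by (simp add: in_keys_iff)
    qed
  qed
qed

text \<open>The preimage consists of the consecutive differences; the value 0 at N + 1 closes the
  telescope.\<close>

lemma W_surj:
  assumes "Poly_Mapping.keys e \<subseteq> {1..N}"
    and "\<And>i. 1 \<le> i \<Longrightarrow> i < N \<Longrightarrow> Poly_Mapping.lookup e (Suc i) \<le> Poly_Mapping.lookup e i"
  obtains m where "Poly_Mapping.keys m \<subseteq> {1..N}" "W m = e"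
proof -
  define m where "m = (\<Sum>i\<in>{1..N}. Poly_Mapping.single i (Poly_Mapping.lookup e i - Poly_Mapping.lookup e (Suc i)))"
  have lm: "Poly_Mapping.lookup m i = (if i \<in> {1..N} then Poly_Mapping.lookup e i - Poly_Mapping.lookup e (Suc i) else 0)" for i
    unfolding m_def lookup_sum lookup_single when_def by (subst sum.delta) auto
  then have km: "Poly_Mapping.keys m \<subseteq> {1..N}" by (auto simp: in_keys_iff split: if_splits)
  have e0: "Poly_Mapping.lookup e i = 0" if "i \<notin> {1..N}" for i
    using that assms(1) by (metis in_keys_iff subsetD)
  have "W m = e"
  proof (rule poly_mapping_eqI)
    fix i
    show "Poly_Mapping.lookup (W m) i = Poly_Mapping.lookup e i"
    proof (cases "i \<in> {1..N}")
      case True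
      have "(\<Sum>v\<in>{i..N}. Poly_Mapping.lookup m v) = (\<Sum>v\<in>{i..N}. Poly_Mapping.lookup e v - Poly_Mapping.lookup e (Suc v))"
        using True by (intro sum.cong) (auto simp: lm)
      also have "\<dots> = Poly_Mapping.lookup e i"
      proof -
        have "Poly_Mapping.lookup e (Suc v) \<le> Poly_Mapping.lookup e v" if "i \<le> v" "v \<le> N" for v
          using that True assms(2)[of v] e0[of "Suc v"] by (cases "v < N") auto
        then show ?thesis
          using sum_nat_telescope[of i N "Poly_Mapping.lookup e"] e0[of "Suc N"] True by simp
      qed
      finally show ?thesis using True by (simp add: lookup_W[OF km])
    next
      case False
      then show ?thesis by (auto simp: lookup_W[OF km] e0)
    qed
  qed
  with km show thesis by (rule that)
qed

text \<open>The weight of \<open>c_j\<close> is the indicator of \<open>{1..j}\<close>, which is the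
  exponent of its generator. The prescribed value of a monomial is therefore its exponent in the
  t_i.\<close>

lemma mon_val_eq:
  assumes "Poly_Mapping.keys m \<subseteq> {1..N}"
  shows "mon_val d n C m = int_exponent (W m)"
proof
  fix i
  have "Spec_weight d n C (chain_elem C j) i = int (Poly_Mapping.lookup (chain_exp j) i)"
    if "j \<in> Poly_Mapping.keys m" for j
  proof -
    have j: "j \<le> N" using that assms by auto
    have "i \<in> {1..N} \<and> root_enum i \<in> S (chain_elem C j) \<longleftrightarrow> i \<in> {1..j}"
      using j root_enum_mem_iff[of i j] by auto
    then show ?thesis by (simp only: Spec_weight_eq[OF chain_elem_closed[OF j]] lookup_chain_exp of_nat_of_bool)
  qed
  then show "mon_val d n C m i = int_exponent (W m) i"
    by (simp add: mon_val_def int_exponent_def lookup_mon_subst)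
qed

text \<open>Injectivity of \<open>W\<close> excludes cancellation.\<close>

lemma keys_push_W:
  assumes "F \<in> carrier T"
  shows "Poly_Mapping.keys (push_mapping W F) = W ` Poly_Mapping.keys F"
  by (rule keys_push_mapping_inj, rule inj_on_subset[OF inj_on_W])
     (use assms in \<open>auto simp: in_carrier_poly_ring\<close>)

lemma push_W_nonzero: "F \<in> carrier T - {0} \<Longrightarrow> push_mapping W F \<noteq> 0"
  using keys_push_W[of F] by (auto simp flip: keys_eq_empty)

lemma poly_val_eq:
  assumes F: "F \<in> carrier T" and a: "is_initial (push_mapping W F) a"
  shows "poly_val d n C F = int_exponent a"
proof -
  have "mon_val d n C ` Poly_Mapping.keys F = (\<lambda>m. int_exponent (W m)) ` Poly_Mapping.keys F"
    by (rule image_cong) (use F mon_val_eq in \<open>auto simp: in_carrier_poly_ring\<close>)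
  then have img: "mon_val d n C ` Poly_Mapping.keys F = int_exponent ` Poly_Mapping.keys (push_mapping W F)"
    by (simp add: keys_push_W[OF F] image_image)
  show ?thesis
    unfolding poly_val_def img
  proof (rule the_equality)
    show "int_exponent a \<in> int_exponent ` Poly_Mapping.keys (push_mapping W F) \<and>
      (\<forall>v\<in>int_exponent ` Poly_Mapping.keys (push_mapping W F). v \<noteq> int_exponent a \<longrightarrow> revlex_less (int_exponent a) v)"
      using a by (auto simp: is_initial_def)
    fix v assume v: "v \<in> int_exponent ` Poly_Mapping.keys (push_mapping W F) \<and>
      (\<forall>u\<in>int_exponent ` Poly_Mapping.keys (push_mapping W F). u \<noteq> v \<longrightarrow> revlex_less v u)"
    then obtain b where "v = int_exponent b" "is_initial (push_mapping W F) b"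
      by (auto simp: is_initial_def int_exponent_inject)
    then show "v = int_exponent a" using is_initial_unique[OF a] by simp
  qed
qed

text \<open>Two representations of h as a quotient cross-multiply to an identity of polynomials.
  Comparing least exponents on both sides gives equal differences of values, which is the uniqueness
  demanded by the definite description.\<close>

lemma valuation_eq:
  assumes h: "h \<in> carrier K" and F: "F \<in> carrier T - {0}" and G: "G \<in> carrier T - {0}"
    and eq: "\<psi> h = to_fract (push_mapping W F) / to_fract (push_mapping W G)"
  shows "valuation d n C h = poly_val d n C F - poly_val d n C G"
  unfolding valuation_def
proof (rule the_equality)
  have quot: "eval_chain d n C A \<otimes>\<^bsub>K\<^esub> inv\<^bsub>K\<^esub> eval_chain d n C B \<in> carrier K"
      "\<psi> (eval_chain d n C A \<otimes>\<^bsub>K\<^esub> inv\<^bsub>K\<^esub> eval_chain d n C B)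
         = to_fract (push_mapping W A) / to_fract (push_mapping W B)"
    if "A \<in> carrier T" "B \<in> carrier T - {0}" for A B
  proof -
    have B: "eval_chain d n C B \<in> carrier K" "\<psi> (eval_chain d n C B) \<noteq> 0"
      using eval_chain[of B] that push_W_nonzero[OF that(2)] by auto
    show "eval_chain d n C A \<otimes>\<^bsub>K\<^esub> inv\<^bsub>K\<^esub> eval_chain d n C B \<in> carrier K"
      using that eval_chain(1)[of A] K_inv(1)[OF B] by (intro K_mult_closed)
    show "\<psi> (eval_chain d n C A \<otimes>\<^bsub>K\<^esub> inv\<^bsub>K\<^esub> eval_chain d n C B)
         = to_fract (push_mapping W A) / to_fract (push_mapping W B)"
      using that eval_chain[of A] eval_chain[of B] K_inv[OF B] by (simp add: K_mult field_simps)
  qed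
  show "\<exists>A\<in>carrier T - {0}. \<exists>B\<in>carrier T - {0}.
      h = eval_chain d n C A \<otimes>\<^bsub>K\<^esub> inv\<^bsub>K\<^esub> eval_chain d n C B \<and>
      poly_val d n C F - poly_val d n C G = poly_val d n C A - poly_val d n C B"
    using F G quot[of F G] h eq by (intro bexI[of _ F] bexI[of _ G] conjI K_inj) auto
  fix v assume "\<exists>A\<in>carrier T - {0}. \<exists>B\<in>carrier T - {0}.
      h = eval_chain d n C A \<otimes>\<^bsub>K\<^esub> inv\<^bsub>K\<^esub> eval_chain d n C B \<and> v = poly_val d n C A - poly_val d n C B"
  then obtain A B where A: "A \<in> carrier T - {0}" and B: "B \<in> carrier T - {0}"
    and hAB: "h = eval_chain d n C A \<otimes>\<^bsub>K\<^esub> inv\<^bsub>K\<^esub> eval_chain d n C B"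
    and v: "v = poly_val d n C A - poly_val d n C B" by blast
  have "to_fract (push_mapping W F) / to_fract (push_mapping W G)
      = to_fract (push_mapping W A) / to_fract (push_mapping W B)"
    using quot(2)[of A B] A B hAB eq by simp
  then have "to_fract (push_mapping W F * push_mapping W B) = to_fract (push_mapping W A * push_mapping W G)"
    using push_W_nonzero[OF G] push_W_nonzero[OF B] by (simp add: frac_eq_eq del: to_fract_simps(5))
  then have cross: "push_mapping W F * push_mapping W B = push_mapping W A * push_mapping W G"
    by (simp only: to_fract_simps(5))
  obtain f where f: "is_initial (push_mapping W F) f" using push_W_nonzero[OF F] by (rule is_initial_exists)
  obtain g where g: "is_initial (push_mapping W G) g" using push_W_nonzero[OF G] by (rule is_initial_exists)
  obtain a where a: "is_initial (push_mapping W A) a" using push_W_nonzero[OF A] by (rule is_initial_exists)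
  obtain b where b: "is_initial (push_mapping W B) b" using push_W_nonzero[OF B] by (rule is_initial_exists)
  have "f + b = a + g"
    using is_initial_mult[OF f b] is_initial_mult[OF a g] cross by (auto intro: is_initial_unique)
  then have "int_exponent f + int_exponent b = int_exponent a + int_exponent g" by (metis int_exponent_add)
  moreover have "poly_val d n C F = int_exponent f" "poly_val d n C G = int_exponent g"
    "poly_val d n C A = int_exponent a" "poly_val d n C B = int_exponent b"
    using F G A B f g a b by (auto intro!: poly_val_eq)
  ultimately show "v = poly_val d n C F - poly_val d n C G"
    unfolding v by (simp add: fun_eq_iff) (metis add_diff_cancel_right' add_diff_eq diff_add_eq)
qed

lemma hibi_class_power:
  "p \<in> carrier P \<Longrightarrow> hibi_class d n p [^]\<^bsub>hibi_ring d n\<^esub> (k::nat) = hibi_class d n (p ^ k) \<and> p ^ k \<in> carrier P"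
  by (induction k)
     (simp_all add: nat_pow_def hibi_class_one hibi_class_mult poly_ring_one_closed poly_ring_mult_closed mult.commute)

text \<open>
  Multiplying by a monomial \<open>W b\<close> with steeply decreasing exponents turns every exponent into a
  nonincreasing one, i.e. one in the image of \<open>W\<close>.
\<close>
lemma chain_quotient:
  assumes "\<And>e. e \<in> Poly_Mapping.keys q \<Longrightarrow> Poly_Mapping.keys e \<subseteq> {0..N} \<and> Poly_Mapping.lookup e 0 = j"
  obtains F b where "F \<in> carrier T" "Poly_Mapping.keys b \<subseteq> {1..N}"
    and "push_mapping W F * Poly_Mapping.single (Poly_Mapping.single 0 j) 1 = q * Poly_Mapping.single (W b) 1"
proof -
  define M where "M = (\<Sum>e\<in>Poly_Mapping.keys q. \<Sum>i\<in>Poly_Mapping.keys e. Poly_Mapping.lookup e i)"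
  have M: "Poly_Mapping.lookup e i \<le> M" if "e \<in> Poly_Mapping.keys q" for e i
  proof -
    have "Poly_Mapping.lookup e i \<le> (\<Sum>i\<in>Poly_Mapping.keys e. Poly_Mapping.lookup e i)"
      by (cases "i \<in> Poly_Mapping.keys e") (auto intro: member_le_sum simp: in_keys_iff)
    also have "\<dots> \<le> M" unfolding M_def using that by (intro member_le_sum) auto
    finally show ?thesis .
  qed
  \<comment> \<open>With all entries of b equal to M, the tail sums \<open>W b\<close> drop by M at
    each step, and no entry of an exponent of q exceeds M.\<close>
  define b where "b = (\<Sum>i\<in>{1..N}. Poly_Mapping.single i M)"
  have lb: "Poly_Mapping.lookup b i = (if i \<in> {1..N} then M else 0)" for i
    unfolding b_def lookup_sum lookup_single when_def by (subst sum.delta) auto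
  then have kb: "Poly_Mapping.keys b \<subseteq> {1..N}" by (auto simp: in_keys_iff split: if_splits)
  have Wb: "Poly_Mapping.lookup (W b) i = M + Poly_Mapping.lookup (W b) (Suc i)" if "1 \<le> i" "i \<le> N" for i
  proof -
    have "{i..N} = insert i {Suc i..N}" using that by auto
    then show ?thesis using that by (simp add: lookup_W[OF kb] lb)
  qed
  have "\<exists>m. Poly_Mapping.keys m \<subseteq> {1..N} \<and> W m + Poly_Mapping.single 0 j = e + W b"
    if e: "e \<in> Poly_Mapping.keys q" for e
  proof -
    \<comment> \<open>Subtracting j clears coordinate 0, where e has exactly the value j and
      \<open>W b\<close> the value 0.\<close>
    define e' where "e' = e + W b - Poly_Mapping.single 0 j"
    have W0: "Poly_Mapping.lookup (W b) 0 = 0" by (simp add: lookup_W[OF kb])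
    have l': "Poly_Mapping.lookup e' i = (if i = 0 then 0 else Poly_Mapping.lookup e i + Poly_Mapping.lookup (W b) i)" for i
      using assms[OF e] W0
      by (simp add: e'_def minus_poly_mapping.rep_eq lookup_add lookup_single when_def)
    have "Poly_Mapping.lookup e i = 0" if "i > N" for i
      using that assms[OF e] by (metis atLeastAtMost_iff in_keys_iff leD subsetD)
    then have "Poly_Mapping.lookup e' i = 0" if "i \<notin> {1..N}" for i
      using that by (auto simp: l' lookup_W[OF kb])
    then have "Poly_Mapping.keys e' \<subseteq> {1..N}" by (metis in_keys_iff subsetI)
    moreover have "Poly_Mapping.lookup e' (Suc i) \<le> Poly_Mapping.lookup e' i" if "1 \<le> i" "i < N" for i
      using that M[OF e, of "Suc i"] Wb[of i] by (simp add: l')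
    ultimately obtain m where m: "Poly_Mapping.keys m \<subseteq> {1..N}" "W m = e'" by (rule W_surj)
    have "e' + Poly_Mapping.single 0 j = e + W b"
      using assms[OF e] W0 by (intro poly_mapping_eqI) (simp add: lookup_add l' lookup_single when_def)
    with m show ?thesis by blast
  qed
  then obtain u where u: "\<And>e. e \<in> Poly_Mapping.keys q \<Longrightarrow>
      Poly_Mapping.keys (u e) \<subseteq> {1..N} \<and> W (u e) + Poly_Mapping.single 0 j = e + W b" by metis
  show thesis
  proof (rule that)
    show "push_mapping u q \<in> carrier T"
      using keys_push_mapping_subset[of u q] u by (auto simp: in_carrier_poly_ring)
    show "Poly_Mapping.keys b \<subseteq> {1..N}" by (rule kb)
    have "push_mapping W (push_mapping u q) * Poly_Mapping.single (Poly_Mapping.single 0 j) 1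
        = push_mapping (\<lambda>e. e + W b) q"
      unfolding push_mapping_comp push_mapping_shift using u by (intro push_mapping_cong) auto
    also have "\<dots> = q * Poly_Mapping.single (W b) 1"
      using push_mapping_shift[of "\<lambda>m. m" q "W b"] by simp
    finally show "push_mapping W (push_mapping u q) * Poly_Mapping.single (Poly_Mapping.single 0 j) 1
        = q * Poly_Mapping.single (W b) 1" .
  qed
qed

lemma keys_subst_E:
  assumes "Poly_Mapping.keys m \<subseteq> L"
  shows "Poly_Mapping.keys (subst_E m) \<subseteq> {0..N}"
  by (auto simp: in_keys_iff lookup_mon_subst lookup_toric_exp split: if_splits)

text \<open>By \<open>chain_quotient\<close> the fraction becomes a quotient of polynomials in the
  generators with a single monomial as denominator. Its exponent \<open>W b\<close> also shifts the
  least exponent of the numerator, so it cancels, and only m minus the exponent of t_0^j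
  remains.\<close>

lemma valuation_hibi:
  assumes p: "p \<in> homogeneous_polys L j" and m: "is_initial (toric p) m"
  shows "valuation d n C (hibi_frac d n (hibi_class d n p)
           (hibi_class d n (pvar (lat_bot d)) [^]\<^bsub>hibi_ring d n\<^esub> j)) = int_exponent m - int_exponent (Poly_Mapping.single 0 j)"
proof -
  let ?x = "pvar (lat_bot d) ^ j" and ?q = "toric p" and ?e0 = "Poly_Mapping.single 0 j :: nat mon"
  have q0: "?q \<noteq> 0" using m by (auto simp: is_initial_def)
  have xeq: "?x = Poly_Mapping.single (Poly_Mapping.single (lat_bot d) j) 1"
  proof -
    have "(\<Sum>_<j. Poly_Mapping.single (lat_bot d) (1::nat)) = Poly_Mapping.single (lat_bot d) j"
      by (intro poly_mapping_eqI) (simp add: lookup_sum lookup_single when_def)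
    then show ?thesis by (simp add: pvar_def single_one_power)
  qed
  have x: "?x \<in> homogeneous_polys L j"
    unfolding xeq using lat_bot_closed[OF d_le] by (intro homogeneous_single) auto
  have tx: "toric ?x = Poly_Mapping.single ?e0 1"
  proof -
    have "subst_E (Poly_Mapping.single (lat_bot d) j) = ?e0"
      by (intro poly_mapping_eqI) (simp add: lookup_mon_subst toric_exp_bot lookup_single when_def)
    then show ?thesis by (simp add: xeq)
  qed
  have xc: "hibi_class d n (pvar (lat_bot d)) [^]\<^bsub>hibi_ring d n\<^esub> j = hibi_class d n ?x"
    using hibi_class_power[OF homogeneous_closed[OF pvar_homogeneous[OF lat_bot_closed[OF d_le]]]] by simp
  define h where "h = hibi_frac d n (hibi_class d n p) (hibi_class d n ?x)"
  have h: "h \<in> carrier K" "\<psi> h = to_fract ?q / to_fract (Poly_Mapping.single ?e0 1)"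
    using hibi_frac[OF p x] by (simp_all add: h_def tx)
  have "Poly_Mapping.keys e \<subseteq> {0..N} \<and> Poly_Mapping.lookup e 0 = j" if e: "e \<in> Poly_Mapping.keys ?q" for e
  proof -
    obtain a where "e = subst_E a" "a \<in> Poly_Mapping.keys p"
      using e keys_push_mapping_subset[of subst_E p] unfolding toric_def by blast
    then show ?thesis
      using p keys_subst_E by (auto simp: homogeneous_polys_def in_carrier_poly_ring lookup_subst_E_zero)
  qed
  then obtain F b where F: "F \<in> carrier T" and b: "Poly_Mapping.keys b \<subseteq> {1..N}"
    and eq: "push_mapping W F * Poly_Mapping.single ?e0 1 = ?q * Poly_Mapping.single (W b) 1"
    using chain_quotient[of ?q j] by metis
  have "push_mapping W F \<noteq> 0" using eq q0 by auto
  then obtain a where a: "is_initial (push_mapping W F) a" by (rule is_initial_exists)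
  have F0: "F \<in> carrier T - {0}" using F \<open>push_mapping W F \<noteq> 0\<close> by auto
  let ?G = "Poly_Mapping.single b (1::complex)"
  have G: "?G \<in> carrier T - {0}"
    using b by (simp add: poly_ring_single_closed)
  have "to_fract (push_mapping W F) * to_fract (Poly_Mapping.single ?e0 1) = to_fract ?q * to_fract (Poly_Mapping.single (W b) 1)"
    using eq by (simp only: flip: to_fract_simps(2))
  then have "\<psi> h = to_fract (push_mapping W F) / to_fract (push_mapping W ?G)"
    unfolding h(2) by (simp add: frac_eq_eq)
  then have val: "valuation d n C h = poly_val d n C F - poly_val d n C ?G"
    by (rule valuation_eq[OF h(1) F0 G])
  have "poly_val d n C F = int_exponent a" "poly_val d n C ?G = int_exponent (W b)"
    using F G a by (auto intro!: poly_val_eq simp: is_initial_single)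
  moreover have "a + ?e0 = m + W b"
    using is_initial_mult[OF a is_initial_single[of ?e0]] is_initial_mult[OF m is_initial_single[of "W b"]] eq
    by (auto intro: is_initial_unique)
  then have "int_exponent a + int_exponent ?e0 = int_exponent m + int_exponent (W b)" by (metis int_exponent_add)
  ultimately have "valuation d n C h = int_exponent m - int_exponent ?e0"
    unfolding val by (simp add: fun_eq_iff) (metis add_diff_cancel_right' add_diff_eq diff_add_eq)
  then show ?thesis by (simp add: h_def xc)
qed

text \<open>The summand for coordinate 0 in \<open>Gamma_val\<close> restores the power of t_0 lost
  to the denominator. The least exponent of \<open>toric p\<close> comes from a monomial of p, and a
  single monomial attains its own exponent.\<close>

lemma Gamma_val_eq:
  "Gamma_val d n C j = {int_exponent (subst_E a) | a. Poly_Mapping.keys a \<subseteq> L \<and> mon_degree a = j}"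
proof (intro equalityI subsetI)
  have shift: "(\<lambda>k. int j * of_bool (k = 0)) + (int_exponent m - int_exponent (Poly_Mapping.single 0 j)) = int_exponent m" for m
    by (auto simp: fun_eq_iff int_exponent_def lookup_single when_def)
  {
    fix v assume "v \<in> Gamma_val d n C j"
    then obtain x where x: "x \<in> hibi_component d n j" "x \<noteq> \<zero>\<^bsub>hibi_ring d n\<^esub>"
      and v: "v = (\<lambda>k. int j * of_bool (k = 0)) + valuation d n C (hibi_frac d n x
          (hibi_class d n (pvar (lat_bot d)) [^]\<^bsub>hibi_ring d n\<^esub> j))"
      by (auto simp: Gamma_val_def)
    obtain p where p: "p \<in> homogeneous_polys L j" "p \<in> carrier P" "x = hibi_class d n p"
      using x(1) by (rule hibi_componentE)
    have "toric p \<noteq> 0"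
      using x(2) p hibi_class_cong[of p 0] by (auto simp: hibi_class_zero poly_ring_zero_closed)
    then obtain m where m: "is_initial (toric p) m" by (rule is_initial_exists)
    have "v = int_exponent m" using valuation_hibi[OF p(1) m] shift by (simp add: v p(3))
    moreover obtain a where "a \<in> Poly_Mapping.keys p" "m = subst_E a"
      using m keys_push_mapping_subset[of subst_E p] by (auto simp: is_initial_def toric_def)
    ultimately show "v \<in> {int_exponent (subst_E a) | a. Poly_Mapping.keys a \<subseteq> L \<and> mon_degree a = j}"
      using p by (auto simp: homogeneous_polys_def in_carrier_poly_ring)
  next
    fix v assume "v \<in> {int_exponent (subst_E a) | a. Poly_Mapping.keys a \<subseteq> L \<and> mon_degree a = j}"
    then obtain a where a: "v = int_exponent (subst_E a)" "Poly_Mapping.keys a \<subseteq> L" "mon_degree a = j" by blast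
    let ?p = "Poly_Mapping.single a (1::complex)"
    have p: "?p \<in> homogeneous_polys L j" using a by (intro homogeneous_single) auto
    have m: "is_initial (toric ?p) (subst_E a)" by (simp add: is_initial_single)
    have "toric_class (hibi_class d n ?p) \<noteq> 0"
      using homogeneous_closed[OF p] m by (auto simp: is_initial_def simp del: toric_simps(6))
    then have "hibi_class d n ?p \<noteq> \<zero>\<^bsub>hibi_ring d n\<^esub>" using hibi.zero by metis
    then show "v \<in> Gamma_val d n C j"
      unfolding Gamma_val_def
      using hibi_componentI[OF p] valuation_hibi[OF p m] shift[of "subst_E a"] a(1)
      by (intro CollectI exI[of _ "hibi_class d n ?p"]) auto
  }
qed

end

section \<open>Order polytopes\<close>

lemma scaleR_fun_apply [simp]: "(c *\<^sub>R f) x = c *\<^sub>R f x"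
  by (simp add: scaleR_fun_def)

lemma convex_order_polytope: "convex (order_polytope A R)"
proof (rule convexI)
  fix f g :: "'a \<Rightarrow> real" and u v :: real
  assume f: "f \<in> order_polytope A R" and g: "g \<in> order_polytope A R" and uv: "0 \<le> u" "0 \<le> v" "u + v = 1"
  have "u * f a + v * g a \<le> 1" if "a \<in> A" for a
    using f g that uv by (intro convex_bound_le) (auto simp: order_polytope_def)
  moreover have "u * f b + v * g b \<le> u * f a + v * g a" if "a \<in> A" "b \<in> A" "R a b" for a b
    using f g that uv by (intro add_mono mult_left_mono) (auto simp: order_polytope_def)
  ultimately show "u *\<^sub>R f + v *\<^sub>R g \<in> order_polytope A R"
    using f g uv by (auto simp: order_polytope_def)
qed

text \<open>Each defining condition involves at most two coordinates, and coordinates are continuous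
  in the product topology.\<close>

lemma closed_order_polytope: "closed (order_polytope A R)"
proof -
  have imp: "closed {x. c \<longrightarrow> Q x}" if "closed {x. Q x}" for c and Q :: "('a \<Rightarrow> real) \<Rightarrow> bool"
    using that by (cases c) auto
  have "closed {f. (\<forall>a. (a \<in> A \<longrightarrow> 0 \<le> f a) \<and> (a \<in> A \<longrightarrow> f a \<le> 1)) \<and>
      (\<forall>a b. a \<in> A \<and> b \<in> A \<and> R a b \<longrightarrow> f b \<le> f a) \<and> (\<forall>a. a \<notin> A \<longrightarrow> f a = (0::real))}"
    by (intro closed_Collect_conj closed_Collect_all imp closed_Collect_le closed_Collect_eq
        continuous_on_const continuous_on_product_coordinates)
  also have "{f. (\<forall>a. (a \<in> A \<longrightarrow> 0 \<le> f a) \<and> (a \<in> A \<longrightarrow> f a \<le> 1)) \<and>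
      (\<forall>a b. a \<in> A \<and> b \<in> A \<and> R a b \<longrightarrow> f b \<le> f a) \<and> (\<forall>a. a \<notin> A \<longrightarrow> f a = (0::real))} = order_polytope A R"
    by (auto simp: order_polytope_def)
  finally show ?thesis .
qed

text \<open>
  Peel off the smallest positive value \<open>a\<close> of a point \<open>f\<close>: it is a convex combination of the
  vertex of the ideal \<open>{f > 0}\<close> and of a point with fewer positive values.
\<close>
lemma order_polytope_subset_hull:
  assumes "finite A"
  shows "order_polytope A R \<subseteq> convex hull ((\<lambda>S a. of_bool (a \<in> S)) ` order_ideals A R)" (is "_ \<subseteq> ?H")
proof
  fix f assume "f \<in> order_polytope A R"
  then show "f \<in> ?H"
  proof (induction "card (f ` A - {0})" arbitrary: f rule: less_induct)
    case less
    define S where "S = {x \<in> A. 0 < f x}"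
    have f: "0 \<le> f x" "f x \<le> 1" if "x \<in> A" for x
      using less.prems that by (auto simp: order_polytope_def)
    have f_mono: "f y \<le> f x" if "x \<in> A" "y \<in> A" "R x y" for x y
      using less.prems that by (auto simp: order_polytope_def)
    have f_out: "f x = 0" if "x \<notin> S" for x
      using less.prems that f[of x] by (cases "x \<in> A") (auto simp: order_polytope_def S_def)
    have "S \<in> order_ideals A R"
      using f_mono by (fastforce simp: order_ideals_def S_def)
    then have S_hull: "(\<lambda>a. of_bool (a \<in> S)) \<in> ?H" by (intro hull_inc) blast
    show ?case
    proof (cases "S = {} \<or> (\<forall>x\<in>S. f x = 1)")
      case True
      then have "f = (\<lambda>a. of_bool (a \<in> S))" using f_out by (auto simp: fun_eq_iff)
      then show ?thesis using S_hull by simp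
    next
      case False
      have finS: "finite S" using assms by (simp add: S_def)
      define a where "a = Min (f ` S)"
      have "a \<in> f ` S" unfolding a_def using finS False by (intro Min_in) auto
      then have a0: "0 < a" and amem: "a \<in> f ` A - {0}" by (auto simp: S_def)
      have a_le: "a \<le> f x" if "x \<in> S" for x
        unfolding a_def using finS that by (intro Min_le) auto
      have a1: "a < 1"
      proof -
        obtain x where "x \<in> S" "f x \<noteq> 1" using False by blast
        then show ?thesis using a_le[of x] f[of x] by (auto simp: S_def)
      qed
      \<comment> \<open>Solves f = a * 1_S + (1 - a) * g for g. Points where f equals a drop to
        0.\<close>
      define g where "g x = (f x - a * of_bool (x \<in> S)) / (1 - a)" for x
      have g0: "0 \<le> g x" for x
        using a_le[of x] f_out[of x] a1 by (auto simp: g_def)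
      have "g x \<le> 1" if "x \<in> A" for x
        using f[OF that] f_out[of x] a1 by (auto simp: g_def)
      moreover have "g y \<le> g x" if "x \<in> A" "y \<in> A" "R x y" for x y
      proof (cases "y \<in> S")
        case True
        then have "x \<in> S" using f_mono[OF that] that by (auto simp: S_def)
        then show ?thesis using True f_mono[OF that] a1 by (auto simp: g_def intro: divide_right_mono)
      next
        case False
        then show ?thesis using g0[of x] f_out[of y] by (simp add: g_def)
      qed
      moreover have "g x = 0" if "x \<notin> A" for x
        using that f_out[of x] by (auto simp: g_def S_def)
      ultimately have gP: "g \<in> order_polytope A R" using g0 by (auto simp: order_polytope_def)
      \<comment> \<open>Nonzero values of g are rescaled values of f other than a, which gives the
        decrease.\<close>
      have "g ` A - {0} \<subseteq> (\<lambda>v. (v - a) / (1 - a)) ` (f ` A - {0} - {a})"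
      proof
        fix v assume "v \<in> g ` A - {0}"
        then obtain x where x: "x \<in> A" "v = g x" "v \<noteq> 0" by blast
        then have "x \<in> S" using f_out[of x] by (cases "x \<in> S") (auto simp: g_def)
        then show "v \<in> (\<lambda>v. (v - a) / (1 - a)) ` (f ` A - {0} - {a})"
          using x by (intro image_eqI[of _ _ "f x"]) (auto simp: g_def S_def)
      qed
      then have "card (g ` A - {0}) \<le> card (f ` A - {0} - {a})"
        using assms by (meson card_image_le card_mono finite_Diff finite_imageI le_trans)
      also have "\<dots> < card (f ` A - {0})"
        using amem assms by (intro card_Diff1_less) auto
      finally have "g \<in> ?H" using less.hyps gP by blast
      then have "a *\<^sub>R (\<lambda>x. of_bool (x \<in> S)) + (1 - a) *\<^sub>R g \<in> ?H"
        using S_hull a0 a1 by (intro convexD[OF convex_convex_hull]) auto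
      also have "a *\<^sub>R (\<lambda>x. of_bool (x \<in> S)) + (1 - a) *\<^sub>R g = f"
        using a1 by (auto simp: fun_eq_iff g_def)
      finally show ?thesis .
    qed
  qed
qed

text \<open>Relabelling coordinates along a bijection is linear and matches the lattice points; the
  translation is 0.\<close>

lemma unimodularly_equivalent_order_polytope:
  assumes bij: "bij_betw \<pi> A B"
  shows "unimodularly_equivalent A (order_polytope A (\<lambda>a b. R (\<pi> a) (\<pi> b))) B (order_polytope B R)"
proof -
  define \<sigma> where "\<sigma> = the_inv_into A \<pi>"
  have \<sigma>: "\<sigma> b \<in> A" "\<pi> (\<sigma> b) = b" if "b \<in> B" for b
    using that bij unfolding \<sigma>_def
    by (auto simp: bij_betw_def intro: f_the_inv_into_f the_inv_into_into[OF _ _ subset_refl])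
  have \<pi>: "\<pi> a \<in> B" "\<sigma> (\<pi> a) = a" if "a \<in> A" for a
    using that bij unfolding \<sigma>_def by (auto simp: bij_betw_def the_inv_into_f_f)
  define f :: "('a \<Rightarrow> real) \<Rightarrow> 'b \<Rightarrow> real" where "f v b = (if b \<in> B then v (\<sigma> b) else 0)" for v b
  define g :: "('b \<Rightarrow> real) \<Rightarrow> 'a \<Rightarrow> real" where "g u a = (if a \<in> A then u (\<pi> a) else 0)" for u a
  have gf: "g (f v) = v" if "\<And>a. a \<notin> A \<Longrightarrow> v a = 0" for v
    using that \<pi> by (auto simp: f_def g_def fun_eq_iff)
  have fg: "f (g u) = u" if "\<And>b. b \<notin> B \<Longrightarrow> u b = 0" for u
    using that \<sigma> by (auto simp: f_def g_def fun_eq_iff)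
  have "linear f"
    by (rule linearI) (auto simp: f_def fun_eq_iff)
  moreover have "bij_betw (\<lambda>v. f v + 0) (int_lattice A) (int_lattice B)"
    by (rule bij_betw_byWitness[where f' = g])
       (use \<sigma> \<pi> in \<open>auto simp: int_lattice_def gf fg, auto simp: f_def g_def\<close>)
  moreover have "(\<lambda>v. f v + 0) ` order_polytope A (\<lambda>a b. R (\<pi> a) (\<pi> b)) = order_polytope B R"
  proof (intro equalityI subsetI)
    fix u assume "u \<in> (\<lambda>v. f v + 0) ` order_polytope A (\<lambda>a b. R (\<pi> a) (\<pi> b))"
    then show "u \<in> order_polytope B R" using \<sigma> by (auto simp: order_polytope_def f_def)
  next
    fix u assume u: "u \<in> order_polytope B R"
    then have "g u \<in> order_polytope A (\<lambda>a b. R (\<pi> a) (\<pi> b))"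
      using \<pi> by (auto simp: order_polytope_def g_def)
    moreover have "u = f (g u) + 0" using u fg[of u] by (simp add: order_polytope_def)
    ultimately show "u \<in> (\<lambda>v. f v + 0) ` order_polytope A (\<lambda>a b. R (\<pi> a) (\<pi> b))" by blast
  qed
  ultimately show ?thesis unfolding unimodularly_equivalent_def by blast
qed

section \<open>The Newton-Okounkov body\<close>

context grassmannian_chain
begin

abbreviation "enum_le \<equiv> \<lambda>i k. root_le (root_enum i) (root_enum k)"

definition real_exponent :: "nat mon \<Rightarrow> nat \<Rightarrow> real" where
  "real_exponent m = (\<lambda>i. real (Poly_Mapping.lookup m i))"

definition e0 :: "nat \<Rightarrow> real" where
  "e0 = (\<lambda>i. of_bool (i = 0))"

lemma scaled_Gamma_val:
  "(\<Union>j\<in>{1..}. {(1 / real j) *\<^sub>R (\<lambda>k. real_of_int (v k)) | v. v \<in> Gamma_val d n C j}) =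
     {(1 / real (mon_degree a)) *\<^sub>R real_exponent (subst_E a) | a. Poly_Mapping.keys a \<subseteq> L \<and> a \<noteq> 0}"
  (is "?l = ?R")
proof -
  have int_exponent: "(\<lambda>k. real_of_int (int_exponent m k)) = real_exponent m" for m by (simp add: int_exponent_def real_exponent_def)
  have "(1 / real j) *\<^sub>R (\<lambda>k. real_of_int (v k)) \<in> ?R" if jv: "1 \<le> j" "v \<in> Gamma_val d n C j" for j v
  proof -
    obtain a where a: "v = int_exponent (subst_E a)" "Poly_Mapping.keys a \<subseteq> L" "mon_degree a = j"
      using jv(2) by (auto simp: Gamma_val_eq)
    then have "a \<noteq> 0" using jv(1) by auto
    then show ?thesis using a(2) unfolding a(1) int_exponent a(3)[symmetric] by blast
  qed
  moreover have "(1 / real (mon_degree a)) *\<^sub>R real_exponent (subst_E a) \<in> ?l"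
    if "Poly_Mapping.keys a \<subseteq> L" "a \<noteq> 0" for a
  proof -
    have "mon_degree a \<in> {1..}" using that(2) mon_degree_eq_0_iff[of a] by auto
    moreover have "int_exponent (subst_E a) \<in> Gamma_val d n C (mon_degree a)"
      using that(1) unfolding Gamma_val_eq by blast
    ultimately show ?thesis unfolding int_exponent[symmetric] by (intro UN_I) auto
  qed
  ultimately show ?thesis by (intro equalityI subsetI) auto
qed

text \<open>All vertices already come from degree one: an ideal of numbers corresponds to an ideal
  of roots, which belongs to a lattice element.\<close>

lemma ideal_vertex:
  assumes "D \<in> order_ideals {1..N} enum_le"
  obtains l where "l \<in> L" "real_exponent (toric_exp l) = e0 + (\<lambda>i. of_bool (i \<in> D))"
proof -
  have D: "D \<subseteq> {1..N}" using assms by (simp add: order_ideals_def)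
  have surj: "root_enum ` {1..N} = \<Phi>" using bij_betw_root_enum by (rule bij_betw_imp_surj_on)
  have inj: "inj_on root_enum {1..N}" using bij_betw_root_enum by (rule bij_betw_imp_inj_on)
  have "root_enum ` D \<in> order_ideals \<Phi> root_le"
    using assms D unfolding surj[symmetric] order_ideals_def by blast
  then obtain l where l: "l \<in> L" "S l = root_enum ` D" by (rule ideal_lift)
  have "i \<in> {1..N} \<and> root_enum i \<in> S l \<longleftrightarrow> i \<in> D" for i
    using D inj_on_image_mem_iff[OF inj _ D, of i] by (auto simp: l(2))
  moreover have "0 < i" if "i \<in> D" for i using D that by auto
  ultimately have "real_exponent (toric_exp l) = e0 + (\<lambda>i. of_bool (i \<in> D))"
    by (auto simp: real_exponent_def e0_def lookup_toric_exp fun_eq_iff simp del: atLeastAtMost_iff)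
  then show thesis using l(1) that by blast
qed

text \<open>Apart from coordinate 0, which scales to 1 and is then removed, the point is the average
  with multiplicities of indicators of order ideals, and the inequalities hold for each
  summand.\<close>

lemma scaled_exponent_in_polytope:
  assumes a: "Poly_Mapping.keys a \<subseteq> L" "a \<noteq> 0"
  shows "(1 / real (mon_degree a)) *\<^sub>R real_exponent (subst_E a) - e0 \<in> order_polytope {1..N} enum_le"
proof -
  have pos: "0 < mon_degree a" using a(2) mon_degree_eq_0_iff[of a] by auto
  let ?x = "Poly_Mapping.lookup (subst_E a)"
  have x0: "?x 0 = mon_degree a" by (rule lookup_subst_E_zero)
  have le: "?x i \<le> mon_degree a" for i
    unfolding lookup_mon_subst mon_degree_def by (intro sum_mono) (simp add: lookup_toric_exp)
  have out: "?x i = 0" if "i \<noteq> 0" "i \<notin> {1..N}" for i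
    using that by (simp only: lookup_mon_subst lookup_toric_exp) simp
  have mono: "?x k \<le> ?x i" if ik: "i \<in> {1..N}" "k \<in> {1..N}" "enum_le i k" for i k
    unfolding lookup_mon_subst
  proof (intro sum_mono mult_left_mono)
    fix l assume "l \<in> Poly_Mapping.keys a"
    then have "S l \<in> order_ideals \<Phi> root_le" using a(1) by (auto intro: spec_roots_ideal)
    then have "root_enum k \<in> S l \<Longrightarrow> root_enum i \<in> S l"
      using ik root_enum_in_roots[OF ik(1)] by (auto simp: order_ideals_def)
    then show "Poly_Mapping.lookup (toric_exp l) k \<le> Poly_Mapping.lookup (toric_exp l) i"
      using ik by (auto simp: lookup_toric_exp)
  qed simp
  show ?thesis
    using pos le out mono x0 atLeastAtMost_iff[of 0 "Suc 0" N]
    by (auto simp: order_polytope_def real_exponent_def e0_def divide_right_mono simp del: atLeastAtMost_iff)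
qed

text \<open>The translated polytope is closed and convex and contains all generating points, so it
  contains the closure of their hull. Conversely it is the hull of its vertices, which are
  generating points of degree one.\<close>

lemma NO_body_homog_eq: "NO_body_homog d n C = (+) e0 ` order_polytope {1..N} enum_le"
proof -
  let ?O = "order_polytope {1..N} enum_le"
  let ?U = "{(1 / real (mon_degree a)) *\<^sub>R real_exponent (subst_E a) | a. Poly_Mapping.keys a \<subseteq> L \<and> a \<noteq> 0}"
  have "closure (convex hull ?U) = (+) e0 ` ?O"
  proof
    have "continuous_on UNIV (\<lambda>v :: nat \<Rightarrow> real. v - e0)"
      by (rule continuous_on_coordinatewise_then_product) (simp add: continuous_on_diff)
    then have "closed ((\<lambda>v. v - e0) -` ?O)"
      by (intro closed_vimage closed_order_polytope)
    also have "(\<lambda>v. v - e0) -` ?O = (+) e0 ` ?O"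
      by (force simp: image_iff algebra_simps)
    finally have cl: "closed ((+) e0 ` ?O)" .
    have "?U \<subseteq> (+) e0 ` ?O"
    proof
      fix v assume "v \<in> ?U"
      then have "v - e0 \<in> ?O" using scaled_exponent_in_polytope by blast
      then show "v \<in> (+) e0 ` ?O" by (intro image_eqI[of _ _ "v - e0"]) auto
    qed
    then show "closure (convex hull ?U) \<subseteq> (+) e0 ` ?O"
      using cl by (intro closure_minimal hull_minimal convex_translation convex_order_polytope)
  next
    let ?V = "(\<lambda>D i. of_bool (i \<in> D)) ` order_ideals {1..N} enum_le"
    have "(+) e0 ` ?V \<subseteq> ?U"
    proof
      fix v assume "v \<in> (+) e0 ` ?V"
      then obtain D where D: "D \<in> order_ideals {1..N} enum_le" "v = e0 + (\<lambda>i. of_bool (i \<in> D))" by blast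
      obtain l where l: "l \<in> L" "real_exponent (toric_exp l) = e0 + (\<lambda>i. of_bool (i \<in> D))"
        using D(1) by (rule ideal_vertex)
      let ?a = "Poly_Mapping.single l 1 :: nat list mon"
      have "?a \<noteq> 0" by (rule single_one_nonzero)
      moreover have "v = (1 / real (mon_degree ?a)) *\<^sub>R real_exponent (subst_E ?a)"
        using l(2) D(2) by (simp add: fun_eq_iff)
      moreover have "Poly_Mapping.keys ?a \<subseteq> L" using l(1) by simp
      ultimately show "v \<in> ?U" by blast
    qed
    then have "convex hull ((+) e0 ` ?V) \<subseteq> convex hull ?U" by (rule hull_mono)
    moreover have "(+) e0 ` ?O \<subseteq> (+) e0 ` (convex hull ?V)"
      by (intro image_mono order_polytope_subset_hull) simp
    ultimately show "(+) e0 ` ?O \<subseteq> closure (convex hull ?U)"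
      using closure_subset[of "convex hull ?U"] unfolding convex_hull_translation by blast
  qed
  then show ?thesis unfolding NO_body_homog_def scaled_Gamma_val .
qed

lemma NO_body_eq: "NO_body d n C = order_polytope {1..N} enum_le"
proof -
  have "(e0 + u)(0 := 0) = u" if "u \<in> order_polytope {1..N} enum_le" for u
    using that by (auto simp: fun_eq_iff e0_def order_polytope_def)
  then show ?thesis by (simp add: NO_body_def NO_body_homog_eq image_image cong: image_cong)
qed

end

theorem proposition7p6:
  fixes d n :: nat and C :: "nat list set"
  assumes "1 \<le> n" and "1 \<le> d" and "d \<le> n"
    and "C \<in> maximal_chains d n"
  shows "unimodularly_equivalent {1..chain_rank d n} (NO_body d n C)
           (root_poset d n) (GT_polytope d n)"
proof -
  interpret grassmannian_chain d n C
    using assms by unfold_locales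
  show ?thesis
    unfolding NO_body_eq GT_polytope_def
    by (rule unimodularly_equivalent_order_polytope[OF bij_betw_root_enum])
qed

end
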